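(* Let $m$ be a positive integer and let $(K,\partial_0,\dots,\partial_{m-1})$ be a field with $m$ commuting derivations. Let $\mu\in\mathbb{N}^m$ and let $n$ be a positive integer, and suppose $K$ has a field extension $K(a_h^{\xi}\colon|\xi|\le|\mu|\land h<n)$ that meets the differential condition, and such that $\sigma\le\mu$ whenever $a_k^{\sigma}$ is a minimal separable leader. Then $(K,\partial_0,\dots,\partial_{m-1})$ has an extension $(M,D_0,\dots,D_{m-1})$ (a field $M\supseteq K$ with $m$ commuting derivations extending the $\partial_i$) compatible with $K(a_h^{\xi}\colon|\xi|<|\mu|\land h<n)$, i.e. $K(a_h^{\xi}\colon|\xi|<|\mu|\land h<n)\subseteq M$ and $D_ia_k^{\sigma}=a_k^{\sigma+\varepsilon_i}$ whenever $i<m$, $k<n$ and $|\sigma|+1<|\mu|$.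
   Context: $n$ denotes also $\{0,\dots,n-1\}$. For $\sigma\in\mathbb{N}^m$, $|\sigma|=\sum_{i<m}\sigma(i)$; $\le$ is the componentwise order on $\mathbb{N}^m$; $\varepsilon_i$ is the characteristic function of $\{i\}$ in $\mathbb{N}^m$. The total order $\unlhd$ on $\mathbb{N}^m\times n$: $(\xi,k)\unlhd(\eta,g)$ iff $(|\xi|,k,\xi(0),\dots,\xi(m-2))$ is lexicographically $\le(|\eta|,g,\eta(0),\dots,\eta(m-2))$; $\lhd$ is the strict version. The extension meets the differential condition if: whenever $i<m$, $k<n$, $|\sigma|+1\le|\mu|$, and $f$ is a polynomial over $K$ in variables $(x_h^{\xi}\colon(\xi,h)\unlhd(\sigma,k))$ vanishing at $a=(a_h^{\xi}\colon(\xi,h)\unlhd(\sigma,k))$, then $\sum_{(\eta,g)\unlhd(\sigma,k)}\frac{\partial f}{\partial x_g^{\eta}}(a)\,a_g^{\eta+\varepsilon_i}+f^{\partial_i}(a)=0$, with $f^{\partial_i}$ being $f$ with $\partial_i$ applied to its coefficients. A generator $a_k^{\sigma}$ is a separable leader if it is separably algebraic over $K(a_h^{\xi}\colon(\xi,h)\lhd(\sigma,k))$, and a minimal separable leader if in addition no $a_k^{\rho}$ with $\rho\le\sigma$, $\rho\ne\sigma$, is a separable leader. *)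

theory Defs
  imports "HOL-Library.Poly_Mapping" "HOL-Computational_Algebra.Polynomial" "HOL-Algebra.Ring"
begin

text \<open>Elements of N^m are represented as functions nat => nat vanishing outside {..<m}.\<close>

definition multi_index :: "nat \<Rightarrow> (nat \<Rightarrow> nat) \<Rightarrow> bool" where
  "multi_index m \<sigma> \<longleftrightarrow> (\<forall>i\<ge>m. \<sigma> i = 0)"

definition mabs :: "nat \<Rightarrow> (nat \<Rightarrow> nat) \<Rightarrow> nat" where
  "mabs m \<sigma> = (\<Sum>i<m. \<sigma> i)"

definition mle :: "nat \<Rightarrow> (nat \<Rightarrow> nat) \<Rightarrow> (nat \<Rightarrow> nat) \<Rightarrow> bool" where
  "mle m \<sigma> \<tau> \<longleftrightarrow> (\<forall>i<m. \<sigma> i \<le> \<tau> i)"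

definition madd :: "(nat \<Rightarrow> nat) \<Rightarrow> (nat \<Rightarrow> nat) \<Rightarrow> nat \<Rightarrow> nat" where
  "madd \<sigma> \<tau> = (\<lambda>j. \<sigma> j + \<tau> j)"

definition eps :: "nat \<Rightarrow> nat \<Rightarrow> nat" where
  "eps i = (\<lambda>j. if j = i then 1 else 0)"

definition ord_key :: "nat \<Rightarrow> (nat \<Rightarrow> nat) \<times> nat \<Rightarrow> nat list" where
  "ord_key m x = mabs m (fst x) # snd x # map (fst x) [0..<m-1]"

definition tri_le :: "nat \<Rightarrow> (nat \<Rightarrow> nat) \<times> nat \<Rightarrow> (nat \<Rightarrow> nat) \<times> nat \<Rightarrow> bool" where
  "tri_le m x y \<longleftrightarrow> ord_key m x = ord_key m y \<or> lexordp (<) (ord_key m x) (ord_key m y)"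

definition tri_less :: "nat \<Rightarrow> (nat \<Rightarrow> nat) \<times> nat \<Rightarrow> (nat \<Rightarrow> nat) \<times> nat \<Rightarrow> bool" where
  "tri_less m x y \<longleftrightarrow> tri_le m x y \<and> x \<noteq> y"

definition is_subfield :: "'a::field set \<Rightarrow> bool" where
  "is_subfield F \<longleftrightarrow> 0 \<in> F \<and> 1 \<in> F \<and>
     (\<forall>x\<in>F. \<forall>y\<in>F. x + y \<in> F \<and> x * y \<in> F) \<and>
     (\<forall>x\<in>F. - x \<in> F \<and> inverse x \<in> F)"

definition gen_field :: "'a::field set \<Rightarrow> 'a set \<Rightarrow> 'a set" where
  "gen_field F S = \<Inter>{E. is_subfield E \<and> F \<union> S \<subseteq> E}"

definition is_derivation :: "'a::field set \<Rightarrow> ('a \<Rightarrow> 'a) \<Rightarrow> bool" where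
  "is_derivation K d \<longleftrightarrow> (\<forall>x\<in>K. d x \<in> K) \<and>
     (\<forall>x\<in>K. \<forall>y\<in>K. d (x + y) = d x + d y \<and> d (x * y) = x * d y + d x * y)"

definition diff_field :: "nat \<Rightarrow> 'a::field set \<Rightarrow> (nat \<Rightarrow> 'a \<Rightarrow> 'a) \<Rightarrow> bool" where
  "diff_field m K d \<longleftrightarrow> is_subfield K \<and> (\<forall>i<m. is_derivation K (d i)) \<and>
     (\<forall>i<m. \<forall>j<m. \<forall>x\<in>K. d i (d j x) = d j (d i x))"

type_synonym ('v, 'a) mpoly = "('v \<Rightarrow>\<^sub>0 nat) \<Rightarrow>\<^sub>0 'a"

definition mpoly_over :: "'a::field set \<Rightarrow> 'v set \<Rightarrow> ('v, 'a) mpoly \<Rightarrow> bool" where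
  "mpoly_over K V f \<longleftrightarrow> (\<forall>t\<in>Poly_Mapping.keys f. poly_mapping.lookup f t \<in> K \<and> Poly_Mapping.keys t \<subseteq> V)"

definition monom_val :: "('v \<Rightarrow>\<^sub>0 nat) \<Rightarrow> ('v \<Rightarrow> 'a::field) \<Rightarrow> 'a" where
  "monom_val t a = (\<Prod>v\<in>Poly_Mapping.keys t. a v ^ poly_mapping.lookup t v)"

definition mpoly_eval :: "('v, 'a::field) mpoly \<Rightarrow> ('v \<Rightarrow> 'a) \<Rightarrow> 'a" where
  "mpoly_eval f a = (\<Sum>t\<in>Poly_Mapping.keys f. poly_mapping.lookup f t * monom_val t a)"

definition mpoly_pderiv_eval :: "('v, 'a::field) mpoly \<Rightarrow> 'v \<Rightarrow> ('v \<Rightarrow> 'a) \<Rightarrow> 'a" where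
  "mpoly_pderiv_eval f v a = (\<Sum>t\<in>Poly_Mapping.keys f. poly_mapping.lookup f t * of_nat (poly_mapping.lookup t v) *
      a v ^ (poly_mapping.lookup t v - 1) * (\<Prod>w\<in>Poly_Mapping.keys t - {v}. a w ^ poly_mapping.lookup t w))"

definition mpoly_coeffmap_eval :: "('a \<Rightarrow> 'a) \<Rightarrow> ('v, 'a::field) mpoly \<Rightarrow> ('v \<Rightarrow> 'a) \<Rightarrow> 'a" where
  "mpoly_coeffmap_eval d f a = (\<Sum>t\<in>Poly_Mapping.keys f. d (poly_mapping.lookup f t) * monom_val t a)"

definition gen_idx :: "nat \<Rightarrow> nat \<Rightarrow> (nat \<Rightarrow> nat) \<Rightarrow> ((nat \<Rightarrow> nat) \<times> nat) set" where
  "gen_idx m n \<mu> = {(\<xi>, h). multi_index m \<xi> \<and> mabs m \<xi> \<le> mabs m \<mu> \<and> h < n}"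

definition vars_le :: "nat \<Rightarrow> nat \<Rightarrow> (nat \<Rightarrow> nat) \<times> nat \<Rightarrow> ((nat \<Rightarrow> nat) \<times> nat) set" where
  "vars_le m n y = {(\<xi>, h). multi_index m \<xi> \<and> h < n \<and> tri_le m (\<xi>, h) y}"

definition vars_less :: "nat \<Rightarrow> nat \<Rightarrow> (nat \<Rightarrow> nat) \<times> nat \<Rightarrow> ((nat \<Rightarrow> nat) \<times> nat) set" where
  "vars_less m n y = {(\<xi>, h). multi_index m \<xi> \<and> h < n \<and> tri_less m (\<xi>, h) y}"

definition differential_condition ::
  "nat \<Rightarrow> nat \<Rightarrow> (nat \<Rightarrow> nat) \<Rightarrow> 'a::field set \<Rightarrow> (nat \<Rightarrow> 'a \<Rightarrow> 'a) \<Rightarrow> ((nat \<Rightarrow> nat) \<times> nat \<Rightarrow> 'a) \<Rightarrow> bool" where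
  "differential_condition m n \<mu> K d a \<longleftrightarrow>
    (\<forall>i \<sigma> k f. i < m \<and> k < n \<and> multi_index m \<sigma> \<and> mabs m \<sigma> + 1 \<le> mabs m \<mu> \<and>
       mpoly_over K (vars_le m n (\<sigma>, k)) f \<and> mpoly_eval f a = 0 \<longrightarrow>
       (\<Sum>(\<eta>, g)\<in>vars_le m n (\<sigma>, k). mpoly_pderiv_eval f (\<eta>, g) a * a (madd \<eta> (eps i), g))
         + mpoly_coeffmap_eval (d i) f a = 0)"

definition is_min_poly :: "'a::field set \<Rightarrow> 'a \<Rightarrow> 'a poly \<Rightarrow> bool" where
  "is_min_poly F x p \<longleftrightarrow> lead_coeff p = 1 \<and> (\<forall>i. coeff p i \<in> F) \<and> poly p x = 0 \<and>
     (\<forall>q. q \<noteq> 0 \<and> (\<forall>i. coeff q i \<in> F) \<and> poly q x = 0 \<longrightarrow> degree p \<le> degree q)"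

definition separably_algebraic :: "'a::field set \<Rightarrow> 'a \<Rightarrow> bool" where
  "separably_algebraic F x \<longleftrightarrow> (\<exists>p. is_min_poly F x p \<and> coprime p (pderiv p))"

definition separable_leader ::
  "nat \<Rightarrow> nat \<Rightarrow> 'a::field set \<Rightarrow> ((nat \<Rightarrow> nat) \<times> nat \<Rightarrow> 'a) \<Rightarrow> (nat \<Rightarrow> nat) \<Rightarrow> nat \<Rightarrow> bool" where
  "separable_leader m n K a \<sigma> k \<longleftrightarrow>
     separably_algebraic (gen_field K (a ` vars_less m n (\<sigma>, k))) (a (\<sigma>, k))"

definition min_separable_leader ::
  "nat \<Rightarrow> nat \<Rightarrow> 'a::field set \<Rightarrow> ((nat \<Rightarrow> nat) \<times> nat \<Rightarrow> 'a) \<Rightarrow> (nat \<Rightarrow> nat) \<Rightarrow> nat \<Rightarrow> bool" where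
  "min_separable_leader m n K a \<sigma> k \<longleftrightarrow> separable_leader m n K a \<sigma> k \<and>
     \<not> (\<exists>\<rho>. multi_index m \<rho> \<and> mle m \<rho> \<sigma> \<and> \<rho> \<noteq> \<sigma> \<and> separable_leader m n K a \<rho> k)"

definition is_derivation_on :: "('b, 'c) ring_scheme \<Rightarrow> ('b \<Rightarrow> 'b) \<Rightarrow> bool" where
  "is_derivation_on M D \<longleftrightarrow> D \<in> carrier M \<rightarrow> carrier M \<and>
     (\<forall>x\<in>carrier M. \<forall>y\<in>carrier M. D (x \<oplus>\<^bsub>M\<^esub> y) = D x \<oplus>\<^bsub>M\<^esub> D y \<and>
        D (x \<otimes>\<^bsub>M\<^esub> y) = (x \<otimes>\<^bsub>M\<^esub> D y) \<oplus>\<^bsub>M\<^esub> (D x \<otimes>\<^bsub>M\<^esub> y))"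

definition field_embedding :: "'a::field set \<Rightarrow> ('b, 'c) ring_scheme \<Rightarrow> ('a \<Rightarrow> 'b) \<Rightarrow> bool" where
  "field_embedding E M \<iota> \<longleftrightarrow> \<iota> ` E \<subseteq> carrier M \<and> inj_on \<iota> E \<and> \<iota> 1 = \<one>\<^bsub>M\<^esub> \<and>
     (\<forall>x\<in>E. \<forall>y\<in>E. \<iota> (x + y) = \<iota> x \<oplus>\<^bsub>M\<^esub> \<iota> y \<and> \<iota> (x * y) = \<iota> x \<otimes>\<^bsub>M\<^esub> \<iota> y)"

end

theory Submission
  imports Defs "HOL-Computational_Algebra.Polynomial_Factorial"
begin

text \<open>Write s for the total degree of \<open>\<mu>\<close> and L for the field generated by the generators of level
  (total degree) below s. The differential condition yields derivations of L into the given field. The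
  generators of level s may satisfy inseparable relations that obstruct further derivation, so they are
  replaced: ordering them, those that are not in the L-affine span of 1 and their predecessors become
  new transcendentals, and the others keep their affine expression. This respects every affine relation,
  hence the derivations of L survive. Above level s, a generator is a new transcendental unless its index
  lies above a leader, in which case it is defined, recursively along the order, as the derivative of a
  preceding leader. Two such definitions agree: the commutator of two derivations is a derivation that
  vanishes, by induction, on everything below a leader, hence on the leader, which is separable; and
  any two leaders immediately below an index of level above s are linked by such commutator steps since
  all minimal leaders are bounded by \<open>\<mu>\<close>.\<close>

section \<open>Derivations along a field embedding\<close>

text \<open>The differential condition concerns vanishing polynomials in generators of level below
  s, but the identity it returns is affine in the generators of level s, with coefficients in L. A
  replacement of level s therefore has to respect affine relations over L only; other relations
  there, separable or not, may be dropped, as the conclusion is about levels below s. Likewise,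
  differentiating the equation of a separable leader gives an equation of degree one, so derivatives
  of leaders of level s - 1 are linear leaders. The recursion above level s must differentiate
  before all values are known. Hence a derivation is made a function of a family of prescribed
  values, and on a field generated by early variables only early values matter, because the order is
  compatible with adding \<open>eps i\<close>. The type \<open>'a list\<close> is met by taking
  rational functions over \<open>'a\<close> in countably many variables, one for each rank, and
  coding them injectively.\<close>

lemma degree_pderiv_le: "degree (pderiv p) \<le> degree p"
  by (rule degree_le) (simp add: coeff_pderiv coeff_eq_0)

lemma is_subfieldD:
  assumes "is_subfield F"
  shows "0 \<in> F" "1 \<in> F" "x \<in> F \<Longrightarrow> y \<in> F \<Longrightarrow> x + y \<in> F" "x \<in> F \<Longrightarrow> y \<in> F \<Longrightarrow> x * y \<in> F"
    "x \<in> F \<Longrightarrow> - x \<in> F" "x \<in> F \<Longrightarrow> inverse x \<in> F"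
    "x \<in> F \<Longrightarrow> y \<in> F \<Longrightarrow> x - y \<in> F" "x \<in> F \<Longrightarrow> y \<in> F \<Longrightarrow> x / y \<in> F"
    "x \<in> F \<Longrightarrow> x ^ e \<in> F"
proof -
  show 1: "0 \<in> F" "1 \<in> F" "x \<in> F \<Longrightarrow> y \<in> F \<Longrightarrow> x + y \<in> F" "x \<in> F \<Longrightarrow> y \<in> F \<Longrightarrow> x * y \<in> F"
    "x \<in> F \<Longrightarrow> - x \<in> F" "x \<in> F \<Longrightarrow> inverse x \<in> F" for x y
    using assms unfolding is_subfield_def by blast+
  show "x \<in> F \<Longrightarrow> y \<in> F \<Longrightarrow> x - y \<in> F" using 1(3)[of x "- y"] 1(5)[of y] by simp
  show "x \<in> F \<Longrightarrow> y \<in> F \<Longrightarrow> x / y \<in> F" using 1(4)[of x "inverse y"] 1(6)[of y] by (simp add: field_simps)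
  show "x \<in> F \<Longrightarrow> x ^ e \<in> F" by (induction e) (auto intro: 1)
qed

lemma subfield_sum: "is_subfield F \<Longrightarrow> (\<And>x. x \<in> A \<Longrightarrow> f x \<in> F) \<Longrightarrow> sum f A \<in> F"
  by (induction A rule: infinite_finite_induct) (auto intro: is_subfieldD)

lemma subfield_prod: "is_subfield F \<Longrightarrow> (\<And>x. x \<in> A \<Longrightarrow> f x \<in> F) \<Longrightarrow> prod f A \<in> F"
  by (induction A rule: infinite_finite_induct) (auto intro: is_subfieldD)

lemma subfield_of_nat: "is_subfield F \<Longrightarrow> of_nat e \<in> F"
  by (induction e) (auto intro: is_subfieldD)

lemma subfield_gen_field: "is_subfield (gen_field F S)"
  unfolding gen_field_def is_subfield_def by auto

lemma gen_field_base: "F \<subseteq> gen_field F S"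
  and gen_field_gens: "S \<subseteq> gen_field F S"
  unfolding gen_field_def by auto

lemma gen_field_least: "is_subfield E \<Longrightarrow> F \<subseteq> E \<Longrightarrow> S \<subseteq> E \<Longrightarrow> gen_field F S \<subseteq> E"
  unfolding gen_field_def by auto

lemma gen_field_mono: "F \<subseteq> F' \<Longrightarrow> S \<subseteq> S' \<Longrightarrow> gen_field F S \<subseteq> gen_field F' S'"
  by (meson gen_field_base gen_field_gens gen_field_least order_trans subfield_gen_field)

text \<open>Derivations of subfields of \<open>'a\<close> will take values in a field of another
  type, so everything is done along an embedding \<open>\<iota>\<close>; \<open>id\<close> recovers
  derivations inside one field.\<close>

locale field_map =
  fixes \<iota> :: "'a::field \<Rightarrow> 'e::field"
  assumes hom_one [simp]: "\<iota> 1 = 1"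
    and hom_add [simp]: "\<iota> (x + y) = \<iota> x + \<iota> y"
    and hom_mult [simp]: "\<iota> (x * y) = \<iota> x * \<iota> y"
begin

lemma hom_zero [simp]: "\<iota> 0 = 0"
  using hom_add[of 0 0] by (metis add.right_neutral add_left_cancel)

lemma hom_minus [simp]: "\<iota> (- x) = - \<iota> x"
  using hom_add[of x "- x"] by (simp del: hom_add add: eq_neg_iff_add_eq_0 add.commute)

lemma hom_diff [simp]: "\<iota> (x - y) = \<iota> x - \<iota> y"
  using hom_add[of x "- y"] by simp

lemma hom_eq_0_iff [simp]: "\<iota> x = 0 \<longleftrightarrow> x = 0"
proof
  assume "\<iota> x = 0"
  then have "\<iota> (x * inverse x) = 0" by simp
  then show "x = 0" by (cases "x = 0") (auto simp del: hom_mult)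
qed simp

lemma hom_eq_iff [simp]: "\<iota> x = \<iota> y \<longleftrightarrow> x = y"
  using hom_eq_0_iff[of "x - y"] by (simp del: hom_eq_0_iff)

lemma hom_inv [simp]: "\<iota> (inverse x) = inverse (\<iota> x)"
proof (cases "x = 0")
  case False
  then have "\<iota> x * \<iota> (inverse x) = 1" by (simp flip: hom_mult)
  then show ?thesis by (simp add: inverse_unique)
qed simp

lemma hom_sum [simp]: "\<iota> (sum f A) = (\<Sum>x\<in>A. \<iota> (f x))"
  by (induction A rule: infinite_finite_induct) auto

lemma hom_power [simp]: "\<iota> (x ^ e) = \<iota> x ^ e"
  by (induction e) auto

lemma subfield_image:
  assumes "is_subfield F"
  shows "is_subfield (\<iota> ` F)"
  unfolding is_subfield_def
proof (intro conjI ballI)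
  note F = is_subfieldD[OF assms]
  show "0 \<in> \<iota> ` F" "1 \<in> \<iota> ` F" using F(1,2) hom_zero hom_one by (metis image_eqI)+
  fix x assume "x \<in> \<iota> ` F"
  then obtain x' where x: "x' \<in> F" "x = \<iota> x'" by auto
  show "- x \<in> \<iota> ` F" "inverse x \<in> \<iota> ` F"
    using F(5,6) x by (metis image_eqI hom_minus, metis image_eqI hom_inv)
  fix y assume "y \<in> \<iota> ` F"
  then obtain y' where y: "y' \<in> F" "y = \<iota> y'" by auto
  show "x + y \<in> \<iota> ` F" "x * y \<in> \<iota> ` F"
    using F(3,4) x y by (metis image_eqI hom_add, metis image_eqI hom_mult)
qed

text \<open>The target field is viewed as an \<open>L\<close>-module through \<open>\<iota>\<close>.
  Values need not lie in the image of \<open>L\<close>, since differentiating raises the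
  level.\<close>

definition deriv_on :: "'a set \<Rightarrow> ('a \<Rightarrow> 'e) \<Rightarrow> bool" where
  "deriv_on L D \<longleftrightarrow> (\<forall>x\<in>L. \<forall>y\<in>L. D (x + y) = D x + D y \<and> D (x * y) = \<iota> x * D y + D x * \<iota> y)"

text \<open>Target sets are modules because three kinds occur: \<open>{0}\<close> for uniqueness and
  vanishing commutators, subfields for containment, and affine spans for the linear relations of
  level s.\<close>

definition submodule :: "'a set \<Rightarrow> 'e set \<Rightarrow> bool" where
  "submodule R T \<longleftrightarrow> 0 \<in> T \<and> (\<forall>x\<in>T. \<forall>y\<in>T. x + y \<in> T) \<and> (\<forall>r\<in>R. \<forall>x\<in>T. \<iota> r * x \<in> T)"

context
  fixes L D
  assumes L: "is_subfield L" and D: "deriv_on L D"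
begin

lemma deriv_add: "x \<in> L \<Longrightarrow> y \<in> L \<Longrightarrow> D (x + y) = D x + D y"
  and deriv_mult: "x \<in> L \<Longrightarrow> y \<in> L \<Longrightarrow> D (x * y) = \<iota> x * D y + D x * \<iota> y"
  using D unfolding deriv_on_def by auto

lemma deriv_0: "D 0 = 0"
  using deriv_add[of 0 0] is_subfieldD(1)[OF L] by (metis add.right_neutral add_left_cancel)

lemma deriv_1: "D 1 = 0"
  using deriv_mult[of 1 1] is_subfieldD(2)[OF L] by (metis hom_one mult_1 mult_1_right add.right_neutral add_left_cancel)

lemma deriv_uminus: "x \<in> L \<Longrightarrow> D (- x) = - D x"
  using deriv_add[of x "- x"] is_subfieldD(5)[OF L] deriv_0 by (simp add: eq_neg_iff_add_eq_0 add.commute)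

lemma deriv_inverse: assumes "x \<in> L" shows "D (inverse x) = - D x * \<iota> (inverse x) * \<iota> (inverse x)"
proof (cases "x = 0")
  case True then show ?thesis by (simp add: deriv_0)
next
  case False
  have "D (x * inverse x) = \<iota> x * D (inverse x) + D x * \<iota> (inverse x)"
    using deriv_mult assms is_subfieldD(6)[OF L] by blast
  then have "\<iota> x * D (inverse x) = - D x * \<iota> (inverse x)"
    using False deriv_1 by (simp add: eq_neg_iff_add_eq_0)
  then have "D (inverse x) = - D x * \<iota> (inverse x) / \<iota> x"
    using False  by (metis hom_eq_0_iff mult.commute nonzero_eq_divide_eq)
  then show ?thesis by (simp add: divide_inverse)
qed

lemma deriv_sum: "(\<And>x. x \<in> A \<Longrightarrow> f x \<in> L) \<Longrightarrow> D (sum f A) = (\<Sum>x\<in>A. D (f x))"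
  by (induction A rule: infinite_finite_induct) (auto simp: deriv_0 deriv_add subfield_sum[OF L])

lemma deriv_power: "x \<in> L \<Longrightarrow> D (x ^ e) = of_nat e * \<iota> (x ^ (e - 1)) * D x"
proof (induction e)
  case (Suc e)
  have "D (x ^ Suc e) = \<iota> x * D (x ^ e) + D x * \<iota> (x ^ e)"
    using deriv_mult[of x "x ^ e"] is_subfieldD(9)[OF L] Suc by simp
  also have "\<dots> = of_nat (Suc e) * \<iota> (x ^ (Suc e - 1)) * D x"
    using Suc by (cases e) (simp_all add: algebra_simps)
  finally show ?case .
qed (simp add: deriv_1)

lemma deriv_poly:
  assumes "x \<in> L" "\<And>i. coeff p i \<in> L"
  shows "D (poly p x) = (\<Sum>i\<le>degree p. \<iota> (x ^ i) * D (coeff p i)) + \<iota> (poly (pderiv p) x) * D x"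
proof -
  have "D (poly p x) = (\<Sum>i\<le>degree p. D (coeff p i * x ^ i))"
    unfolding poly_altdef using assms by (intro deriv_sum) (auto intro: is_subfieldD[OF L])
  also have "\<dots> = (\<Sum>i\<le>degree p. \<iota> (x ^ i) * D (coeff p i) + \<iota> (coeff p i) * (of_nat i * \<iota> (x ^ (i - 1)) * D x))"
    using assms by (intro sum.cong) (auto simp: deriv_mult deriv_power is_subfieldD[OF L] mult.commute)
  also have "\<dots> = (\<Sum>i\<le>degree p. \<iota> (x ^ i) * D (coeff p i)) + (\<Sum>i\<le>degree p. \<iota> (coeff p i) * of_nat i * \<iota> (x ^ (i - 1))) * D x"
    by (simp add: sum.distrib sum_distrib_right mult.assoc)
  also have "(\<Sum>i\<le>degree p. \<iota> (coeff p i) * of_nat i * \<iota> (x ^ (i - 1))) = \<iota> (poly (pderiv p) x)"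
  proof -
    have of_nat: "\<iota> (of_nat e) = of_nat e" for e by (induction e) auto
    have "poly (pderiv p) x = (\<Sum>i\<le>degree p. coeff (pderiv p) i * x ^ i)"
      unfolding poly_altdef by (intro sum.mono_neutral_left) (auto simp: coeff_eq_0 intro: order_trans[OF _ degree_pderiv_le])
    also have "\<dots> = (\<Sum>i\<le>degree p. of_nat (Suc i) * coeff p (Suc i) * x ^ i)" by (simp add: coeff_pderiv)
    also have "\<dots> = (\<Sum>i\<le>Suc (degree p). of_nat i * coeff p i * x ^ (i - 1))"
      by (subst sum.atMost_Suc_shift) simp
    also have "\<dots> = (\<Sum>i\<le>degree p. of_nat i * coeff p i * x ^ (i - 1))" by (simp add: coeff_eq_0)
    finally show ?thesis by (simp add: of_nat mult.commute)
  qed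
  finally show ?thesis .
qed

text \<open>The elements sent into \<open>T\<close> form a subfield: the rules for sums, products
  and inverses produce only combinations of values with scalars in the generated field, hence in
  \<open>R\<close>.\<close>

lemma deriv_gen_field_into:
  assumes sub: "gen_field F S \<subseteq> L" "gen_field F S \<subseteq> R" and T: "submodule R T"
    and F: "D ` F \<subseteq> T" and S: "D ` S \<subseteq> T"
  shows "D ` gen_field F S \<subseteq> T"
proof -
  let ?G = "gen_field F S"
  let ?E = "{x \<in> ?G. D x \<in> T}"
  note G = is_subfieldD[OF subfield_gen_field[of F S]]
  have T': "0 \<in> T" "\<And>x y. x \<in> T \<Longrightarrow> y \<in> T \<Longrightarrow> x + y \<in> T" "\<And>r x. r \<in> ?G \<Longrightarrow> x \<in> T \<Longrightarrow> \<iota> r * x \<in> T"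
      "\<And>r x. r \<in> ?G \<Longrightarrow> x \<in> T \<Longrightarrow> x * \<iota> r \<in> T"
    using T sub unfolding submodule_def by (auto simp: mult.commute)
  have neg: "- x \<in> T" if "x \<in> T" for x using T'(3)[of "- 1" x] G(5)[OF G(2)] that by auto
  have "is_subfield ?E"
    unfolding is_subfield_def
  proof (intro conjI ballI)
    show "0 \<in> ?E" "1 \<in> ?E" using G T' deriv_0 deriv_1 by auto
    fix x assume x: "x \<in> ?E"
    then have xL: "x \<in> L" using sub by auto
    show "- x \<in> ?E" using x G neg deriv_uminus[OF xL] by auto
    have "- D x * \<iota> (inverse x) * \<iota> (inverse x) \<in> T"
      using x G(6) by (intro T'(4) neg) auto
    then show "inverse x \<in> ?E" using x G deriv_inverse[OF xL] by auto
    fix y assume y: "y \<in> ?E"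
    then have yL: "y \<in> L" using sub by auto
    show "x + y \<in> ?E" using x y G T' deriv_add[OF xL yL] by auto
    show "x * y \<in> ?E" using x y G T' deriv_mult[OF xL yL] by auto
  qed
  then have "?G \<subseteq> ?E"
    using F S gen_field_base[of F S] gen_field_gens[of S F] by (intro gen_field_least) auto
  then show ?thesis by auto
qed

text \<open>Differentiating p(x) = 0 expresses p'(x) D x through the derivatives of the
  coefficients, and p'(x) is nonzero by coprimality. The scalars are powers of x and 1/p'(x), which
  is why \<open>R\<close> contains x along with \<open>F\<close>.\<close>

lemma deriv_separable_into:
  assumes sep: "separably_algebraic F x" and x: "x \<in> L" and FL: "F \<subseteq> L"
    and R: "is_subfield R" "F \<subseteq> R" "x \<in> R" and T: "submodule R T" and F: "D ` F \<subseteq> T"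
  shows "D x \<in> T"
proof -
  obtain p where p: "is_min_poly F x p" "coprime p (pderiv p)" using sep unfolding separably_algebraic_def by auto
  have cF: "\<And>i. coeff p i \<in> F" and px: "poly p x = 0" using p unfolding is_min_poly_def by auto
  have px': "poly (pderiv p) x \<noteq> 0"
  proof
    assume "poly (pderiv p) x = 0"
    then have "[:- x, 1:] dvd p" "[:- x, 1:] dvd pderiv p" using px by (simp_all add: poly_eq_0_iff_dvd)
    then have "is_unit [:- x, 1:]" using p(2) coprime_common_divisor by blast
    then show False by (simp add: is_unit_iff_degree)
  qed
  note RR = is_subfieldD[OF R(1)]
  let ?q = "poly (pderiv p) x"
  have qR: "?q \<in> R" unfolding poly_altdef coeff_pderiv
    using cF R by (intro subfield_sum[OF R(1)]) (auto intro!: RR subfield_of_nat simp del: of_nat_Suc)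
  have "0 = (\<Sum>i\<le>degree p. \<iota> (x ^ i) * D (coeff p i)) + \<iota> ?q * D x"
    using deriv_poly[of x p] x cF FL px deriv_0 by force
  then have "\<iota> ?q * D x = - (\<Sum>i\<le>degree p. \<iota> (x ^ i) * D (coeff p i))"
    by (simp add: eq_neg_iff_add_eq_0 add.commute)
  then have "D x = - (\<Sum>i\<le>degree p. \<iota> (x ^ i) * D (coeff p i)) / \<iota> ?q"
    using px' by (metis hom_eq_0_iff mult.commute nonzero_eq_divide_eq)
  then have eq: "D x = \<iota> (- inverse ?q) * (\<Sum>i\<le>degree p. \<iota> (x ^ i) * D (coeff p i))"
    by (simp add: divide_inverse mult.commute)
  have "(\<Sum>i\<in>A. \<iota> (x ^ i) * D (coeff p i)) \<in> T" for A
  proof (induction A rule: infinite_finite_induct)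
    case (insert i A)
    have "\<iota> (x ^ i) * D (coeff p i) \<in> T" using T RR(9)[OF R(3)] F cF unfolding submodule_def by blast
    then show ?case using insert T unfolding submodule_def by simp
  qed (use T in \<open>auto simp: submodule_def\<close>)
  then show ?thesis unfolding eq using T qR RR(5,6) unfolding submodule_def by blast
qed

end

lemma submodule_zero: "submodule R {0}"
  unfolding submodule_def by auto

lemma deriv_diff: "deriv_on L D \<Longrightarrow> deriv_on L D' \<Longrightarrow> deriv_on L (\<lambda>x. D x - D' x)"
  unfolding deriv_on_def by (simp add: algebra_simps)

lemma deriv_unique:
  assumes "deriv_on (gen_field F S) D" "deriv_on (gen_field F S) D'"
    and "\<And>x. x \<in> F \<union> S \<Longrightarrow> D x = D' x" "x \<in> gen_field F S"
  shows "D x = D' x"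
  using deriv_gen_field_into[OF subfield_gen_field deriv_diff[OF assms(1,2)] subset_refl subset_refl submodule_zero] assms(3,4)
  by force

end

lemma field_map_id: "field_map id"
  by unfold_locales auto

section \<open>Extension of derivations to fraction fields\<close>

definition fractions :: "'a::field set \<Rightarrow> 'a set" where
  "fractions R = {p / q |p q. p \<in> R \<and> q \<in> R \<and> q \<noteq> 0}"

locale subring_set =
  fixes R :: "'a::field set"
  assumes R1: "1 \<in> R" and Radd: "x \<in> R \<Longrightarrow> y \<in> R \<Longrightarrow> x + y \<in> R"
    and Rmult: "x \<in> R \<Longrightarrow> y \<in> R \<Longrightarrow> x * y \<in> R" and Rneg: "x \<in> R \<Longrightarrow> - x \<in> R"
begin

lemma subset_fractions: "R \<subseteq> fractions R"
  unfolding fractions_def using R1 by force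

lemma subfield_fractions: "is_subfield (fractions R)"
  unfolding is_subfield_def
proof (intro conjI ballI)
  have R0: "0 \<in> R" using Radd[OF R1 Rneg[OF R1]] by simp
  then show "0 \<in> fractions R" "1 \<in> fractions R" using R1 subset_fractions by auto
  fix x assume "x \<in> fractions R"
  then obtain p q where x: "x = p / q" "p \<in> R" "q \<in> R" "q \<noteq> 0" unfolding fractions_def by auto
  have "- x = (- p) / q" using x by simp
  then show "- x \<in> fractions R" unfolding fractions_def using x Rneg by blast
  show "inverse x \<in> fractions R"
  proof (cases "p = 0")
    case True then show ?thesis using \<open>0 \<in> fractions R\<close> x by simp
  next
    case False
    have "inverse x = q / p" using x by simp
    then show ?thesis unfolding fractions_def using x False by blast
  qed
  fix y assume "y \<in> fractions R"
  then obtain p' q' where y: "y = p' / q'" "p' \<in> R" "q' \<in> R" "q' \<noteq> 0" unfolding fractions_def by auto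
  have "x + y = (p * q' + p' * q) / (q * q')" "x * y = (p * p') / (q * q')" "q * q' \<noteq> 0"
    using x y by (auto simp: field_simps)
  then show "x + y \<in> fractions R" "x * y \<in> fractions R"
    unfolding fractions_def using x y Radd Rmult by blast+
qed

end

context field_map begin

text \<open>The quotient rule, in the form D(p/q) = (D p - (p/q) D q) / q.\<close>
lemma deriv_fractions:
  assumes "subring_set R" and D: "deriv_on R D"
  obtains D' where "deriv_on (fractions R) D'" "\<And>x. x \<in> R \<Longrightarrow> D' x = D x"
proof -
  interpret subring_set R by fact
  have add: "D (x + y) = D x + D y" and mult: "D (x * y) = \<iota> x * D y + D x * \<iota> y"
    if "x \<in> R" "y \<in> R" for x y using D that unfolding deriv_on_def by auto
  define D' where "D' x = (SOME y. \<exists>p q. p \<in> R \<and> q \<in> R \<and> q \<noteq> 0 \<and> x = p / q \<and> y = (D p - \<iota> x * D q) / \<iota> q)" for x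
  have uniq: "(D p - \<iota> (p / q) * D q) / \<iota> q = (D p' - \<iota> (p' / q') * D q') / \<iota> q'"
    if "p \<in> R" "q \<in> R" "q \<noteq> 0" "p' \<in> R" "q' \<in> R" "q' \<noteq> 0" "p / q = p' / q'" for p q p' q'
  proof -
    define c where "c = p / q"
    have p: "p = c * q" "p' = c * q'" using that(3,6) unfolding c_def by simp (simp add: that(6,7))
    \<comment> \<open>Cross-multiplied, equal fractions give one element of \<open>R\<close>, where
      the product rule is available.\<close>
    have "D (p * q') = D (p' * q)" using p by (simp add: mult.commute mult.left_commute)
    then have "\<iota> p * D q' + D p * \<iota> q' = \<iota> p' * D q + D p' * \<iota> q" using that mult by simp
    then have "\<iota> q' * (D p - \<iota> c * D q) = \<iota> q * (D p' - \<iota> c * D q')" unfolding p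
      by (simp add: algebra_simps)
    then show ?thesis using that unfolding c_def[symmetric] that(7)[symmetric]
      by (simp add: frac_eq_eq mult.commute)
  qed
  have D': "D' (p / q) = (D p - \<iota> (p / q) * D q) / \<iota> q" if "p \<in> R" "q \<in> R" "q \<noteq> 0" for p q
    unfolding D'_def
  proof (rule some_equality)
    show "\<exists>p' q'. p' \<in> R \<and> q' \<in> R \<and> q' \<noteq> 0 \<and> p / q = p' / q' \<and>
      (D p - \<iota> (p / q) * D q) / \<iota> q = (D p' - \<iota> (p / q) * D q') / \<iota> q'"
      using that by blast
    fix y assume "\<exists>p' q'. p' \<in> R \<and> q' \<in> R \<and> q' \<noteq> 0 \<and> p / q = p' / q' \<and> y = (D p' - \<iota> (p / q) * D q') / \<iota> q'"
    then show "y = (D p - \<iota> (p / q) * D q) / \<iota> q" using uniq[of p q] that by metis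
  qed
  show thesis
  proof
    show "D' x = D x" if "x \<in> R" for x
    proof -
      have "D 1 = 0" using mult[of 1 1] R1 by (metis hom_one mult_1 mult_1_right add.right_neutral add_left_cancel)
      then show ?thesis using D'[of x 1] that R1 by simp
    qed
    show "deriv_on (fractions R) D'" unfolding deriv_on_def
    proof (intro ballI conjI)
      fix x y assume "x \<in> fractions R" "y \<in> fractions R"
      then obtain p q p' q' where x: "x = p / q" "p \<in> R" "q \<in> R" "q \<noteq> 0"
        and y: "y = p' / q'" "p' \<in> R" "q' \<in> R" "q' \<noteq> 0" unfolding fractions_def by blast
      have px: "p = x * q" and py: "p' = y * q'" using x y by auto
      have q: "q * q' \<in> R" "q * q' \<noteq> 0" "p * q' \<in> R" "p' * q \<in> R" using x y Rmult by auto
      have Dx: "D' x = (D p - \<iota> x * D q) / \<iota> q" and Dy: "D' y = (D p' - \<iota> y * D q') / \<iota> q'"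
        using D' x y by auto
      have xy: "x + y = (p * q' + p' * q) / (q * q')" "x * y = (p * p') / (q * q')"
        using x y by (auto simp: field_simps)
      have nz: "\<iota> q \<noteq> 0" "\<iota> q' \<noteq> 0" using x y by auto
      have "D' (x + y) = (D (p * q' + p' * q) - \<iota> (x + y) * D (q * q')) / \<iota> (q * q')"
        using D'[of "p * q' + p' * q" "q * q'"] q Radd unfolding xy(1)[symmetric] by blast
      also have "D (p * q' + p' * q) = \<iota> p * D q' + D p * \<iota> q' + (\<iota> p' * D q + D p' * \<iota> q)"
        using add[OF q(3,4)] mult x y by simp
      also have "D (q * q') = \<iota> q * D q' + D q * \<iota> q'" using mult x y by simp
      also have "(\<iota> p * D q' + D p * \<iota> q' + (\<iota> p' * D q + D p' * \<iota> q) - \<iota> (x + y) * (\<iota> q * D q' + D q * \<iota> q')) / \<iota> (q * q')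
        = D' x + D' y"
        unfolding Dx Dy using nz unfolding px py hom_mult hom_add by (simp add: field_simps)
      finally show "D' (x + y) = D' x + D' y" .
      have "D' (x * y) = (D (p * p') - \<iota> (x * y) * D (q * q')) / \<iota> (q * q')"
        using D'[of "p * p'" "q * q'"] q Rmult x y unfolding xy(2)[symmetric] by blast
      also have "D (p * p') = \<iota> p * D p' + D p * \<iota> p'"
        using mult x y by simp
      also have "D (q * q') = \<iota> q * D q' + D q * \<iota> q'" using mult x y by simp
      also have "(\<iota> p * D p' + D p * \<iota> p' - \<iota> (x * y) * (\<iota> q * D q' + D q * \<iota> q')) / \<iota> (q * q')
        = \<iota> x * D' y + D' x * \<iota> y"
        unfolding Dx Dy using nz unfolding px py hom_mult hom_add by (simp add: field_simps)
      finally show "D' (x * y) = \<iota> x * D' y + D' x * \<iota> y" .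
    qed
  qed
qed

end

section \<open>Evaluation and partial derivatives of multivariate polynomials\<close>

lemma monom_val_superset:
  "finite S \<Longrightarrow> Poly_Mapping.keys t \<subseteq> S \<Longrightarrow> monom_val t a = (\<Prod>v\<in>S. a v ^ poly_mapping.lookup t v)"
  unfolding monom_val_def by (rule prod.mono_neutral_left) (auto simp: in_keys_iff)

lemma monom_val_add: "monom_val (s + t) a = monom_val s a * monom_val t a"
proof -
  let ?S = "Poly_Mapping.keys s \<union> Poly_Mapping.keys t"
  have "monom_val (s + t) a = (\<Prod>v\<in>?S. a v ^ poly_mapping.lookup (s + t) v)"
    by (rule monom_val_superset) (use keys_add[of s t] in auto)
  also have "\<dots> = monom_val s a * monom_val t a"
    using monom_val_superset[of ?S s a] monom_val_superset[of ?S t a]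
    by (simp add: lookup_add power_add prod.distrib)
  finally show ?thesis .
qed

text \<open>For exponent 0 the truncated \<open>lookup t v - 1\<close> does no harm, because the
  factor \<open>of_nat 0\<close> vanishes.\<close>

definition monom_pderiv :: "'v \<Rightarrow> ('v \<Rightarrow>\<^sub>0 nat) \<Rightarrow> ('v \<Rightarrow> 'a::field) \<Rightarrow> 'a" where
  "monom_pderiv v t a = of_nat (poly_mapping.lookup t v) * a v ^ (poly_mapping.lookup t v - 1) *
    (\<Prod>w\<in>Poly_Mapping.keys t - {v}. a w ^ poly_mapping.lookup t w)"

text \<open>Over the common support, with the factor of \<open>v\<close> split off, the remaining
  factors are multiplicative and the claim becomes the product rule for powers of
  \<open>a v\<close>.\<close>

lemma monom_pderiv_add:
  "monom_pderiv v (s + t) a = monom_val s a * monom_pderiv v t a + monom_pderiv v s a * monom_val t a"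
proof -
  let ?S = "insert v (Poly_Mapping.keys s \<union> Poly_Mapping.keys t)"
  define R where "R u = (\<Prod>w\<in>?S - {v}. a w ^ poly_mapping.lookup u w)" for u
  have R: "(\<Prod>w\<in>Poly_Mapping.keys u - {v}. a w ^ poly_mapping.lookup u w) = R u"
    if "Poly_Mapping.keys u \<subseteq> ?S" for u
    unfolding R_def
  proof (rule prod.mono_neutral_left)
    show "\<forall>w\<in>?S - {v} - (Poly_Mapping.keys u - {v}). a w ^ poly_mapping.lookup u w = 1"
    proof
      fix w assume "w \<in> ?S - {v} - (Poly_Mapping.keys u - {v})"
      then have "w \<notin> Poly_Mapping.keys u" by blast
      then show "a w ^ poly_mapping.lookup u w = 1" by (simp add: in_keys_iff)
    qed
  qed (use that in auto)
  have P: "monom_pderiv v u a = of_nat (poly_mapping.lookup u v) * a v ^ (poly_mapping.lookup u v - 1) * R u"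
    if "Poly_Mapping.keys u \<subseteq> ?S" for u
    unfolding monom_pderiv_def R[OF that] ..
  have M: "monom_val u a = a v ^ poly_mapping.lookup u v * R u" if "Poly_Mapping.keys u \<subseteq> ?S" for u
    using monom_val_superset[OF _ that, of a] unfolding R_def by (simp add: prod.remove[of ?S v] del: Diff_insert_absorb)
  have S: "Poly_Mapping.keys s \<subseteq> ?S" "Poly_Mapping.keys t \<subseteq> ?S" "Poly_Mapping.keys (s + t) \<subseteq> ?S"
    using keys_add[of s t] by auto
  have "R (s + t) = R s * R t" unfolding R_def by (simp add: lookup_add power_add prod.distrib)
  \<comment> \<open>The exponents of \<open>v\<close> are split into zero and successor because of
    the truncated subtraction.\<close>
  then show ?thesis unfolding P[OF S(1)] P[OF S(2)] P[OF S(3)] M[OF S(1)] M[OF S(2)]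
    by (cases "poly_mapping.lookup s v"; cases "poly_mapping.lookup t v")
      (simp_all add: lookup_add algebra_simps power_add)
qed

lemma mpoly_pderiv_eval_alt:
  "mpoly_pderiv_eval f v a = (\<Sum>t\<in>Poly_Mapping.keys f. poly_mapping.lookup f t * monom_pderiv v t a)"
  unfolding mpoly_pderiv_eval_def monom_pderiv_def by (simp add: mult.assoc)

lemma poly_mapping_sum_single:
  "f = (\<Sum>t\<in>Poly_Mapping.keys f. Poly_Mapping.single t (poly_mapping.lookup f t))"
proof (rule poly_mapping_eqI)
  fix k
  show "poly_mapping.lookup f k = poly_mapping.lookup (\<Sum>t\<in>Poly_Mapping.keys f. Poly_Mapping.single t (poly_mapping.lookup f t)) k"
    by (simp add: lookup_sum lookup_single when_def in_keys_iff)
qed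

text \<open>The common shape of evaluation and of \<open>mpoly_deriv\<close> below, so that sums and
  products of polynomials are expanded once for both.\<close>

definition coeff_sum :: "(('v \<Rightarrow>\<^sub>0 nat) \<Rightarrow> 'a::field \<Rightarrow> 'e::field) \<Rightarrow> ('v, 'a) mpoly \<Rightarrow> 'e" where
  "coeff_sum \<phi> f = (\<Sum>t\<in>Poly_Mapping.keys f. \<phi> t (poly_mapping.lookup f t))"

text \<open>Additivity is asked only on \<open>K\<close>, where the derivation of the coefficients
  is known to be additive.\<close>

locale coeff_additive =
  fixes K :: "'a::field set" and \<phi> :: "('v \<Rightarrow>\<^sub>0 nat) \<Rightarrow> 'a \<Rightarrow> 'e::field"
  assumes K: "is_subfield K"
    and add: "x \<in> K \<Longrightarrow> y \<in> K \<Longrightarrow> \<phi> t (x + y) = \<phi> t x + \<phi> t y"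
begin

lemma phi_0: "\<phi> t 0 = 0"
  using add[of 0 0] is_subfieldD(1)[OF K] by (metis add.right_neutral add_left_cancel)

lemma coeff_sum_add:
  assumes "\<And>t. poly_mapping.lookup f t \<in> K" "\<And>t. poly_mapping.lookup g t \<in> K"
  shows "coeff_sum \<phi> (f + g) = coeff_sum \<phi> f + coeff_sum \<phi> g"
  unfolding coeff_sum_def by (rule setsum_keys_plus_distrib) (auto simp: phi_0 add assms)

lemma coeff_sum_single: "coeff_sum \<phi> (Poly_Mapping.single t c) = \<phi> t c"
  unfolding coeff_sum_def by (auto simp: phi_0)

lemma coeff_sum_sum:
  assumes "\<And>i t. i \<in> A \<Longrightarrow> poly_mapping.lookup (p i) t \<in> K"
  shows "coeff_sum \<phi> (\<Sum>i\<in>A. p i) = (\<Sum>i\<in>A. coeff_sum \<phi> (p i))"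
  using assms
proof (induction A rule: infinite_finite_induct)
  case (insert i A)
  then show ?case by (simp add: coeff_sum_add lookup_sum subfield_sum[OF K])
qed (auto simp: coeff_sum_def)

lemma coeff_sum_mult:
  assumes f: "\<And>t. poly_mapping.lookup f t \<in> K" and g: "\<And>t. poly_mapping.lookup g t \<in> K"
  shows "coeff_sum \<phi> (f * g) = (\<Sum>s\<in>Poly_Mapping.keys f. \<Sum>t\<in>Poly_Mapping.keys g.
    \<phi> (s + t) (poly_mapping.lookup f s * poly_mapping.lookup g t))"
proof -
  let ?m = "\<lambda>s t. Poly_Mapping.single (s + t) (poly_mapping.lookup f s * poly_mapping.lookup g t)"
  have k: "poly_mapping.lookup (?m s t) u \<in> K" for s t u
    using f g by (auto simp: lookup_single when_def intro: is_subfieldD[OF K])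
  have "f * g = (\<Sum>s\<in>Poly_Mapping.keys f. \<Sum>t\<in>Poly_Mapping.keys g. ?m s t)"
    by (subst poly_mapping_sum_single[of f], subst poly_mapping_sum_single[of g])
      (simp add: sum_product mult_single)
  then show ?thesis
    by (simp add: coeff_sum_sum coeff_sum_single k lookup_sum subfield_sum[OF K])
qed

end

lemma mpoly_eval_coeff_sum: "mpoly_eval f a = coeff_sum (\<lambda>t c. c * monom_val t a) f"
  unfolding mpoly_eval_def coeff_sum_def ..

lemma mpoly_over_lookup: "is_subfield K \<Longrightarrow> mpoly_over K V f \<Longrightarrow> poly_mapping.lookup f t \<in> K"
  unfolding mpoly_over_def using is_subfieldD(1) by (metis in_keys_iff)

lemma mpoly_eval_add: "mpoly_eval (f + g) a = mpoly_eval f a + mpoly_eval g a"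
proof -
  interpret coeff_additive UNIV "\<lambda>t c. c * monom_val t a"
    by unfold_locales (auto simp: is_subfield_def algebra_simps)
  show ?thesis unfolding mpoly_eval_coeff_sum by (rule coeff_sum_add) auto
qed

lemma mpoly_eval_single: "mpoly_eval (Poly_Mapping.single t c) a = c * monom_val t a"
  unfolding mpoly_eval_def by auto

lemma mpoly_eval_mult: "mpoly_eval (f * g) a = mpoly_eval f a * mpoly_eval g a"
proof -
  interpret coeff_additive UNIV "\<lambda>t c. c * monom_val t a"
    by unfold_locales (auto simp: is_subfield_def algebra_simps)
  show ?thesis unfolding mpoly_eval_coeff_sum
    by (subst coeff_sum_mult) (auto simp: coeff_sum_def sum_product monom_val_add mult_ac)
qed

lemma mpoly_over_add: "is_subfield K \<Longrightarrow> mpoly_over K V f \<Longrightarrow> mpoly_over K V g \<Longrightarrow> mpoly_over K V (f + g)"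
  using keys_add[of f g] is_subfieldD(3)[of K] mpoly_over_lookup[of K V f] mpoly_over_lookup[of K V g]
  unfolding mpoly_over_def by (auto simp: lookup_add)

lemma mpoly_over_single: "c \<in> K \<Longrightarrow> Poly_Mapping.keys t \<subseteq> V \<Longrightarrow> mpoly_over K V (Poly_Mapping.single t c)"
  unfolding mpoly_over_def by auto

lemma mpoly_over_sum:
  assumes "is_subfield K" "\<And>i. i \<in> A \<Longrightarrow> mpoly_over K V (f i)"
  shows "mpoly_over K V (sum f A)"
  using assms(2) by (induction A rule: infinite_finite_induct)
    (auto simp: mpoly_over_add[OF assms(1)] mpoly_over_def[of _ _ 0])

lemma mpoly_over_mult:
  assumes K: "is_subfield K" and f: "mpoly_over K V f" and g: "mpoly_over K V g"
  shows "mpoly_over K V (f * g)"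
proof -
  have "f * g = (\<Sum>s\<in>Poly_Mapping.keys f. \<Sum>t\<in>Poly_Mapping.keys g.
      Poly_Mapping.single (s + t) (poly_mapping.lookup f s * poly_mapping.lookup g t))"
    by (subst poly_mapping_sum_single[of f], subst poly_mapping_sum_single[of g])
      (simp add: sum_product mult_single)
  moreover have "Poly_Mapping.keys (s + t) \<subseteq> V"
    if "s \<in> Poly_Mapping.keys f" "t \<in> Poly_Mapping.keys g" for s t
    using keys_add[of s t] f g that unfolding mpoly_over_def by blast
  ultimately show ?thesis using mpoly_over_lookup[OF K] f g
    by (auto intro!: mpoly_over_sum[OF K] mpoly_over_single is_subfieldD(4)[OF K])
qed

section \<open>Derivations prescribed on generators\<close>

context field_map begin

text \<open>The value at f(a) forced on any derivation along \<open>\<iota>\<close> that restricts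
  to \<open>\<delta>\<close> on the coefficients and sends each \<open>a v\<close> to
  \<open>\<beta> v\<close>.\<close>

definition mpoly_deriv :: "('a \<Rightarrow> 'e) \<Rightarrow> ('v \<Rightarrow> 'a) \<Rightarrow> ('v \<Rightarrow> 'e) \<Rightarrow> ('v, 'a) mpoly \<Rightarrow> 'e" where
  "mpoly_deriv \<delta> a \<beta> = coeff_sum (\<lambda>t c. \<delta> c * \<iota> (monom_val t a) +
     \<iota> c * (\<Sum>v\<in>Poly_Mapping.keys t. \<iota> (monom_pderiv v t a) * \<beta> v))"

lemma monom_pderiv_notin: "v \<notin> Poly_Mapping.keys t \<Longrightarrow> monom_pderiv v t a = 0"
  unfolding monom_pderiv_def by (simp add: in_keys_iff)

text \<open>Collects the terms variable by variable, the shape in which the differential condition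
  is stated.\<close>

lemma mpoly_deriv_eq:
  assumes V: "finite V" "mpoly_over K V f"
  shows "mpoly_deriv \<delta> a \<beta> f = (\<Sum>v\<in>V. \<iota> (mpoly_pderiv_eval f v a) * \<beta> v) +
    (\<Sum>t\<in>Poly_Mapping.keys f. \<delta> (poly_mapping.lookup f t) * \<iota> (monom_val t a))"
proof -
  have "(\<Sum>v\<in>Poly_Mapping.keys t. \<iota> (monom_pderiv v t a) * \<beta> v) = (\<Sum>v\<in>V. \<iota> (monom_pderiv v t a) * \<beta> v)"
    if "t \<in> Poly_Mapping.keys f" for t
    using that V unfolding mpoly_over_def
    by (intro sum.mono_neutral_left) (auto simp: monom_pderiv_notin)
  then have "mpoly_deriv \<delta> a \<beta> f = (\<Sum>t\<in>Poly_Mapping.keys f. \<delta> (poly_mapping.lookup f t) * \<iota> (monom_val t a))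
     + (\<Sum>t\<in>Poly_Mapping.keys f. \<Sum>v\<in>V. \<iota> (poly_mapping.lookup f t) * \<iota> (monom_pderiv v t a) * \<beta> v)"
    unfolding mpoly_deriv_def coeff_sum_def by (simp add: sum.distrib sum_distrib_left mult.assoc)
  then show ?thesis
    by (subst (asm) sum.swap) (simp add: mpoly_pderiv_eval_alt sum_distrib_right)
qed

context
  fixes K :: "'a set" and \<delta> :: "'a \<Rightarrow> 'e" and a :: "'v \<Rightarrow> 'a" and \<beta> :: "'v \<Rightarrow> 'e"
  assumes K: "is_subfield K" and \<delta>: "deriv_on K \<delta>"
begin

interpretation C: coeff_additive K "\<lambda>t c. \<delta> c * \<iota> (monom_val t a) +
     \<iota> c * (\<Sum>v\<in>Poly_Mapping.keys t. \<iota> (monom_pderiv v t a) * \<beta> v)"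
  by unfold_locales (auto simp: K deriv_add[OF K \<delta>] algebra_simps)

lemma mpoly_deriv_add:
  "mpoly_over K V f \<Longrightarrow> mpoly_over K V g \<Longrightarrow> mpoly_deriv \<delta> a \<beta> (f + g) = mpoly_deriv \<delta> a \<beta> f + mpoly_deriv \<delta> a \<beta> g"
  unfolding mpoly_deriv_def by (rule C.coeff_sum_add) (auto simp: mpoly_over_lookup[OF K])

lemma mpoly_deriv_single:
  "mpoly_deriv \<delta> a \<beta> (Poly_Mapping.single t c) = \<delta> c * \<iota> (monom_val t a) +
     \<iota> c * (\<Sum>v\<in>Poly_Mapping.keys t. \<iota> (monom_pderiv v t a) * \<beta> v)"
  unfolding mpoly_deriv_def by (rule C.coeff_sum_single)

lemma mpoly_deriv_mult:
  assumes f: "mpoly_over K V f" and g: "mpoly_over K V g"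
  shows "mpoly_deriv \<delta> a \<beta> (f * g) = \<iota> (mpoly_eval f a) * mpoly_deriv \<delta> a \<beta> g + mpoly_deriv \<delta> a \<beta> f * \<iota> (mpoly_eval g a)"
proof -
  define \<pi> where "\<pi> t = (\<Sum>v\<in>Poly_Mapping.keys t. \<iota> (monom_pderiv v t a) * \<beta> v)" for t
  define e where "e t c = \<iota> (c * monom_val t a)" for t c
  define \<phi> where "\<phi> t c = \<delta> c * \<iota> (monom_val t a) + \<iota> c * \<pi> t" for t c
  have \<pi>: "\<pi> (s + t) = \<iota> (monom_val s a) * \<pi> t + \<pi> s * \<iota> (monom_val t a)" for s t
  proof -
    let ?S = "Poly_Mapping.keys s \<union> Poly_Mapping.keys t"
    have \<pi>S: "\<pi> u = (\<Sum>v\<in>?S. \<iota> (monom_pderiv v u a) * \<beta> v)" if "Poly_Mapping.keys u \<subseteq> ?S" for u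
      unfolding \<pi>_def using that by (intro sum.mono_neutral_left) (auto simp: monom_pderiv_notin)
    show ?thesis
      using keys_add[of s t]
      by (simp add: \<pi>S monom_pderiv_add sum_distrib_left sum_distrib_right sum.distrib[symmetric] algebra_simps)
  qed
  have \<phi>: "\<phi> (s + t) (x * y) = e s x * \<phi> t y + \<phi> s x * e t y" if "x \<in> K" "y \<in> K" for s t x y
    unfolding \<phi>_def e_def \<pi> deriv_mult[OF K \<delta> that] by (simp add: monom_val_add algebra_simps)
  have fg: "mpoly_deriv \<delta> a \<beta> h = coeff_sum \<phi> h" for h unfolding mpoly_deriv_def \<phi>_def \<pi>_def ..
  have ev: "\<iota> (mpoly_eval h a) = (\<Sum>t\<in>Poly_Mapping.keys h. e t (poly_mapping.lookup h t))" for h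
    unfolding mpoly_eval_def e_def by simp
  have "mpoly_deriv \<delta> a \<beta> (f * g) = (\<Sum>s\<in>Poly_Mapping.keys f. \<Sum>t\<in>Poly_Mapping.keys g.
    \<phi> (s + t) (poly_mapping.lookup f s * poly_mapping.lookup g t))"
    unfolding mpoly_deriv_def using C.coeff_sum_mult[of f g] mpoly_over_lookup[OF K] f g
    unfolding \<phi>_def \<pi>_def by blast
  also have "\<dots> = (\<Sum>s\<in>Poly_Mapping.keys f. \<Sum>t\<in>Poly_Mapping.keys g.
     e s (poly_mapping.lookup f s) * \<phi> t (poly_mapping.lookup g t) + \<phi> s (poly_mapping.lookup f s) * e t (poly_mapping.lookup g t))"
    by (intro sum.cong refl \<phi> mpoly_over_lookup[OF K f] mpoly_over_lookup[OF K g])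
  also have "\<dots> = \<iota> (mpoly_eval f a) * coeff_sum \<phi> g + coeff_sum \<phi> f * \<iota> (mpoly_eval g a)"
    unfolding ev coeff_sum_def by (simp add: sum.distrib sum_product)
  finally show ?thesis unfolding fg .
qed

text \<open>On the ring of values f(a), the derivation is read off any representing polynomial;
  \<open>rel\<close> makes this well defined because \<open>mpoly_deriv\<close> is additive. The
  quotient rule then reaches the generated field. \<open>V\<close> may be infinite, as the set of
  new variables can be.\<close>

lemma deriv_extension:
  assumes rel: "\<And>f. mpoly_over K V f \<Longrightarrow> mpoly_eval f a = 0 \<Longrightarrow> mpoly_deriv \<delta> a \<beta> f = 0"
  obtains D where "deriv_on (gen_field K (a ` V)) D" "\<And>x. x \<in> K \<Longrightarrow> D x = \<delta> x" "\<And>v. v \<in> V \<Longrightarrow> D (a v) = \<beta> v"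
proof -
  let ?P = "{f. mpoly_over K V f}"
  let ?R = "(\<lambda>f. mpoly_eval f a) ` ?P"
  let ?D = "mpoly_deriv \<delta> a \<beta>"
  define D0 where "D0 x = ?D (SOME f. f \<in> ?P \<and> mpoly_eval f a = x)" for x
  note KK = is_subfieldD[OF K]
  \<comment> \<open>Negation is written as multiplication by the constant -1, so that the rules for
    products apply to it.\<close>
  have neg: "mpoly_over K V (Poly_Mapping.single 0 (- 1) * f)" if "mpoly_over K V f" for f
    using that KK by (intro mpoly_over_mult[OF K] mpoly_over_single) auto
  have ev_neg: "mpoly_eval (Poly_Mapping.single 0 (- 1) * f) a = - mpoly_eval f a" for f
    by (simp add: mpoly_eval_mult mpoly_eval_single monom_val_def)
  have D_neg: "?D (Poly_Mapping.single 0 (- 1) * f) = - ?D f" if "mpoly_over K V f" for f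
    using mpoly_deriv_mult[of V "Poly_Mapping.single 0 (- 1)" f] that
      mpoly_over_single[of "- 1" K 0 V] KK(5)[OF KK(2)]
    by (simp add: mpoly_deriv_single mpoly_eval_single monom_val_def deriv_uminus[OF K \<delta> KK(2)] deriv_1[OF K \<delta>])
  have D0: "D0 (mpoly_eval f a) = ?D f" if f: "mpoly_over K V f" for f
  proof -
    define g where "g = (SOME g. g \<in> ?P \<and> mpoly_eval g a = mpoly_eval f a)"
    have g: "mpoly_over K V g" "mpoly_eval g a = mpoly_eval f a"
      using someI[of "\<lambda>g. g \<in> ?P \<and> mpoly_eval g a = mpoly_eval f a" f] f unfolding g_def by auto
    have "mpoly_eval (f + Poly_Mapping.single 0 (- 1) * g) a = 0"
      using g by (simp add: mpoly_eval_add ev_neg)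
    then have "?D (f + Poly_Mapping.single 0 (- 1) * g) = 0"
      by (intro rel mpoly_over_add[OF K] f neg g)
    then have "?D f = ?D g" using f g neg by (simp add: mpoly_deriv_add D_neg)
    then show ?thesis unfolding D0_def g_def by simp
  qed
  have c: "mpoly_over K V (Poly_Mapping.single 0 x)" if "x \<in> K" for x
    using that by (intro mpoly_over_single) auto
  have v: "mpoly_over K V (Poly_Mapping.single (Poly_Mapping.single v 1) 1)" if "v \<in> V" for v
    using that KK by (intro mpoly_over_single) auto
  have ev_c: "mpoly_eval (Poly_Mapping.single 0 x) a = x" for x
    by (simp add: mpoly_eval_single monom_val_def)
  have ev_v: "mpoly_eval (Poly_Mapping.single (Poly_Mapping.single v 1) 1) a = a v" for v
    by (simp add: mpoly_eval_single monom_val_def)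
  interpret subring_set ?R
  proof
    show "1 \<in> ?R" using c[OF KK(2)] ev_c by (metis (mono_tags, lifting) image_eqI mem_Collect_eq)
    fix x assume "x \<in> ?R"
    then obtain f where f: "mpoly_over K V f" "x = mpoly_eval f a" by auto
    show "- x \<in> ?R" using neg[OF f(1)] ev_neg f(2) by (metis (mono_tags, lifting) image_eqI mem_Collect_eq)
    fix y assume "y \<in> ?R"
    then obtain g where g: "mpoly_over K V g" "y = mpoly_eval g a" by auto
    show "x + y \<in> ?R" using mpoly_over_add[OF K f(1) g(1)] mpoly_eval_add f(2) g(2)
      by (metis (mono_tags, lifting) image_eqI mem_Collect_eq)
    show "x * y \<in> ?R" using mpoly_over_mult[OF K f(1) g(1)] mpoly_eval_mult f(2) g(2)
      by (metis (mono_tags, lifting) image_eqI mem_Collect_eq)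
  qed
  have "deriv_on ?R D0" unfolding deriv_on_def
    by (auto simp: mpoly_eval_add[symmetric] mpoly_eval_mult[symmetric] D0 mpoly_over_add[OF K] mpoly_over_mult[OF K]
        mpoly_deriv_add mpoly_deriv_mult)
  then obtain D where D: "deriv_on (fractions ?R) D" "\<And>x. x \<in> ?R \<Longrightarrow> D x = D0 x"
    using deriv_fractions[OF subring_set_axioms] by blast
  have KR: "x \<in> ?R" if "x \<in> K" for x using c[OF that] ev_c by (metis (mono_tags, lifting) image_eqI mem_Collect_eq)
  have VR: "a v \<in> ?R" if "v \<in> V" for v using v[OF that] ev_v by (metis (mono_tags, lifting) image_eqI mem_Collect_eq)
  have "gen_field K (a ` V) \<subseteq> fractions ?R"
    using KR VR subset_fractions by (intro gen_field_least subfield_fractions) auto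
  with D(1) have "deriv_on (gen_field K (a ` V)) D" unfolding deriv_on_def by blast
  moreover have "D x = \<delta> x" if "x \<in> K" for x
    using D(2)[OF KR[OF that]] D0[OF c[OF that]] by (simp add: ev_c mpoly_deriv_single monom_val_def)
  moreover have "D (a w) = \<beta> w" if "w \<in> V" for w
    using D(2)[OF VR[OF that]] D0[OF v[OF that], unfolded ev_v]
    by (simp add: mpoly_deriv_single monom_pderiv_def deriv_1[OF K \<delta>])
  ultimately show thesis using that by blast
qed

end
end

section \<open>The order on indices\<close>

definition idx :: "nat \<Rightarrow> nat \<Rightarrow> ((nat \<Rightarrow> nat) \<times> nat) set" where
  "idx m n = {(\<xi>, h). multi_index m \<xi> \<and> h < n}"

definition shift :: "nat \<Rightarrow> (nat \<Rightarrow> nat) \<times> nat \<Rightarrow> (nat \<Rightarrow> nat) \<times> nat" where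
  "shift i u = (madd (fst u) (eps i), snd u)"

definition level :: "nat \<Rightarrow> (nat \<Rightarrow> nat) \<times> nat \<Rightarrow> nat" where
  "level m u = mabs m (fst u)"

text \<open>Only finitely many indices precede a given one, as the level is compared first. The rank
  thus embeds the order into the natural numbers; it serves induction, recursion and the numbering
  of variables.\<close>

definition rank :: "nat \<Rightarrow> nat \<Rightarrow> (nat \<Rightarrow> nat) \<times> nat \<Rightarrow> nat" where
  "rank m n u = card (vars_less m n u)"

lemma shift_idx: "u \<in> idx m n \<Longrightarrow> i < m \<Longrightarrow> shift i u \<in> idx m n"
  unfolding idx_def shift_def multi_index_def madd_def eps_def by auto

lemma shift_commute: "shift i (shift j u) = shift j (shift i u)"
  unfolding shift_def madd_def by (auto simp: add.commute add.left_commute)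

lemma shift_inj: "shift i u = shift i v \<Longrightarrow> u = v"
  unfolding shift_def madd_def by (auto simp: fun_eq_iff prod_eq_iff)

lemma level_shift: "i < m \<Longrightarrow> level m (shift i u) = Suc (level m u)"
  unfolding level_def shift_def mabs_def madd_def eps_def by (simp add: sum.distrib)

lemma lexordp_iff:
  "lexordp (<) ([]::nat list) ys \<longleftrightarrow> ys \<noteq> []"
  "\<not> lexordp (<) (xs::nat list) []"
  "lexordp (<) (x # xs) (y # ys) \<longleftrightarrow> x < y \<or> x = y \<and> lexordp (<) xs ys" for x :: nat
  unfolding lexordp_def by (auto simp: neq_Nil_conv)

lemma lexordp_irrefl: "\<not> lexordp (<) xs (xs :: nat list)"
  by (induction xs) (auto simp: lexordp_iff)

lemma lexordp_trans: "lexordp (<) xs ys \<Longrightarrow> lexordp (<) ys zs \<Longrightarrow> lexordp (<) xs (zs :: nat list)"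
proof (induction zs arbitrary: xs ys)
  case (Cons z zs)
  then show ?case by (cases xs; cases ys) (auto simp: lexordp_iff)
qed (simp add: lexordp_iff)

lemma lexordp_total: "xs \<noteq> ys \<Longrightarrow> lexordp (<) xs ys \<or> lexordp (<) ys (xs :: nat list)"
proof (induction ys arbitrary: xs)
  case (Cons y ys)
  then show ?case by (cases xs) (auto simp: lexordp_iff)
qed (auto simp: lexordp_iff neq_Nil_conv)

lemma lexordp_map2_add:
  assumes "lexordp (<) xs ys" "length xs = length ys" "length zs = length (ys :: nat list)"
  shows "lexordp (<) (map2 (+) xs zs) (map2 (+) ys zs)"
  using assms
proof (induction xs arbitrary: ys zs)
  case (Cons x xs)
  then show ?case by (cases ys; cases zs) (auto simp: lexordp_iff)
qed (simp add: lexordp_iff)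

text \<open>The key omits coordinate m - 1, which is recovered from the sum of all
  coordinates.\<close>

lemma ord_key_inj:
  assumes "u \<in> idx m n" "v \<in> idx m n" "ord_key m u = ord_key m v" "m > 0"
  shows "u = v"
proof -
  obtain \<xi> h \<eta> g where uv: "u = (\<xi>, h)" "v = (\<eta>, g)" by fastforce
  obtain p where m: "m = Suc p" using assms(4) by (cases m) auto
  have s: "mabs m \<xi> = mabs m \<eta>" and h: "h = g" and l: "map \<xi> [0..<p] = map \<eta> [0..<p]"
    using assms(3) uv m unfolding ord_key_def by auto
  have le: "\<xi> i = \<eta> i" if "i < p" for i using l that by (simp add: map_eq_conv)
  then have "\<xi> p = \<eta> p" using s unfolding mabs_def m by simp
  then have "\<xi> i = \<eta> i" for i
    using le[of i] assms(1,2) uv unfolding idx_def multi_index_def m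
    by (cases "i < p"; cases "i = p") auto
  then show ?thesis using uv h by auto
qed

lemma finite_multi_index: "finite {\<xi>. multi_index m \<xi> \<and> mabs m \<xi> \<le> N}"
proof (rule finite_subset)
  show "{\<xi>. multi_index m \<xi> \<and> mabs m \<xi> \<le> N} \<subseteq> {\<xi>. \<forall>i. (i \<in> {..<m} \<longrightarrow> \<xi> i \<in> {..N}) \<and> (i \<notin> {..<m} \<longrightarrow> \<xi> i = 0)}"
  proof
    fix \<xi> assume *: "\<xi> \<in> {\<xi>. multi_index m \<xi> \<and> mabs m \<xi> \<le> N}"
    have "\<xi> i \<le> N" if "i < m" for i
      using * member_le_sum[of i "{..<m}" \<xi>] that unfolding mabs_def by auto
    then show "\<xi> \<in> {\<xi>. \<forall>i. (i \<in> {..<m} \<longrightarrow> \<xi> i \<in> {..N}) \<and> (i \<notin> {..<m} \<longrightarrow> \<xi> i = 0)}"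
      using * unfolding multi_index_def by auto
  qed
qed (rule finite_set_of_finite_funs; simp)

lemma finite_idx_level: "finite {u \<in> idx m n. level m u \<le> N}"
proof (rule finite_subset)
  show "{u \<in> idx m n. level m u \<le> N} \<subseteq> {\<xi>. multi_index m \<xi> \<and> mabs m \<xi> \<le> N} \<times> {..<n}"
    unfolding idx_def level_def by auto
qed (simp add: finite_multi_index)

lemma tri_less_iff:
  assumes "m > 0" "u \<in> idx m n" "v \<in> idx m n"
  shows "tri_less m u v \<longleftrightarrow> lexordp (<) (ord_key m u) (ord_key m v)"
  using ord_key_inj[OF assms(2,3) _ assms(1)] lexordp_irrefl[of "ord_key m u"]
  unfolding tri_less_def tri_le_def by auto

lemma vars_less_eq: "vars_less m n v = {u \<in> idx m n. tri_less m u v}"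
  unfolding vars_less_def idx_def by auto

lemma vars_le_eq: "vars_le m n v = {u \<in> idx m n. tri_le m u v}"
  unfolding vars_le_def idx_def by auto

lemma tri_le_level: "tri_le m u v \<Longrightarrow> level m u \<le> level m v"
  unfolding tri_le_def ord_key_def level_def by (auto simp: lexordp_iff)

lemma finite_vars_le: "finite (vars_le m n v)"
  unfolding vars_le_eq by (rule finite_subset[OF _ finite_idx_level[of m n "level m v"]]) (auto dest: tri_le_level)

lemma finite_vars_less: "finite (vars_less m n v)"
  by (rule finite_subset[OF _ finite_vars_le[of m n v]]) (auto simp: vars_less_eq vars_le_eq tri_less_def)

lemma tri_less_trans:
  assumes "m > 0" "u \<in> idx m n" "v \<in> idx m n" "w \<in> idx m n" "tri_less m u v" "tri_less m v w"
  shows "tri_less m u w"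
  using assms(5,6) lexordp_trans
  unfolding tri_less_iff[OF assms(1,2,3)] tri_less_iff[OF assms(1,3,4)] tri_less_iff[OF assms(1,2,4)] by blast

lemma tri_less_total:
  assumes "m > 0" "u \<in> idx m n" "v \<in> idx m n" "u \<noteq> v"
  shows "tri_less m u v \<or> tri_less m v u"
  using lexordp_total ord_key_inj[OF assms(2,3) _ assms(1)] assms(4)
  unfolding tri_less_iff[OF assms(1,2,3)] tri_less_iff[OF assms(1,3,2)] by blast

lemma rank_less_iff:
  assumes "m > 0" "u \<in> idx m n" "v \<in> idx m n"
  shows "rank m n u < rank m n v \<longleftrightarrow> tri_less m u v"
proof -
  have *: "rank m n x < rank m n y" if "tri_less m x y" "x \<in> idx m n" "y \<in> idx m n" for x y
  proof -
    have "vars_less m n x \<subset> vars_less m n y"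
    proof (rule psubsetI)
      show "vars_less m n x \<subseteq> vars_less m n y"
        unfolding vars_less_eq using that tri_less_trans[OF assms(1) _ that(2,3)] by blast
      show "vars_less m n x \<noteq> vars_less m n y"
        unfolding vars_less_eq using that by (auto simp: tri_less_def)
    qed
    then show ?thesis unfolding rank_def by (rule psubset_card_mono[OF finite_vars_less])
  qed
  show ?thesis
  proof
    assume r: "rank m n u < rank m n v"
    then have "u \<noteq> v" by blast
    then show "tri_less m u v" using tri_less_total[OF assms] *[of v u] assms r by auto
  qed (use * assms in auto)
qed

lemma rank_inj:
  assumes "m > 0" "u \<in> idx m n" "v \<in> idx m n" "rank m n u = rank m n v"
  shows "u = v"
  using tri_less_total[OF assms(1-3)] assms(4) rank_less_iff[OF assms(1-3)] rank_less_iff[OF assms(1,3,2)] by auto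

lemma level_rank:
  assumes "m > 0" "u \<in> idx m n" "v \<in> idx m n" "level m u < level m v"
  shows "rank m n u < rank m n v"
  using assms(4) unfolding rank_less_iff[OF assms(1-3)] tri_less_iff[OF assms(1-3)]
  by (simp add: ord_key_def level_def lexordp_iff)

lemma rank_level:
  assumes "m > 0" "u \<in> idx m n" "v \<in> idx m n" "rank m n u \<le> rank m n v"
  shows "level m u \<le> level m v"
  using assms level_rank[of m v n u] by force

text \<open>Adding \<open>eps i\<close> translates the key by a fixed vector, and lexicographic
  comparison is invariant under translation. For i = m - 1 only the level entry changes.\<close>

lemma ord_key_shift:
  assumes "i < m"
  shows "ord_key m (shift i u) = map2 (+) (ord_key m u) (1 # 0 # map (eps i) [0..<m-1])"
proof (rule nth_equalityI)
  fix j assume "j < length (ord_key m (shift i u))"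
  then show "ord_key m (shift i u) ! j = map2 (+) (ord_key m u) (1 # 0 # map (eps i) [0..<m-1]) ! j"
    using level_shift[OF assms, of u] unfolding ord_key_def shift_def madd_def level_def
    by (cases j; cases "j - 1") auto
qed (simp add: ord_key_def)

text \<open>The derivative of what precedes u precedes the derivative of u: the recursion along the
  order rests on this.\<close>

lemma rank_shift_mono:
  assumes "m > 0" "u \<in> idx m n" "v \<in> idx m n" "i < m" "rank m n u < rank m n v"
  shows "rank m n (shift i u) < rank m n (shift i v)"
proof -
  note s = shift_idx[OF assms(2,4)] shift_idx[OF assms(3,4)]
  have "lexordp (<) (ord_key m u) (ord_key m v)"
    using assms(5) unfolding rank_less_iff[OF assms(1-3)] tri_less_iff[OF assms(1-3)] .
  then show ?thesis
    unfolding rank_less_iff[OF assms(1) s] tri_less_iff[OF assms(1) s] ord_key_shift[OF assms(4)]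
    by (rule lexordp_map2_add) (simp_all add: ord_key_def)
qed

lemma rank_shift:
  assumes "m > 0" "u \<in> idx m n" "i < m"
  shows "rank m n u < rank m n (shift i u)"
  using assms by (intro level_rank) (auto simp: shift_idx level_shift)

lemma vars_less_rank: "m > 0 \<Longrightarrow> v \<in> idx m n \<Longrightarrow> vars_less m n v = {u \<in> idx m n. rank m n u < rank m n v}"
  unfolding vars_less_eq by (auto simp: rank_less_iff)

text \<open>The greatest index of level N has all its weight on coordinate 0 and k = n - 1. One
  instance of the differential condition then covers every polynomial in the generators of level at
  most N.\<close>

lemma level_eq_vars_le:
  assumes "m > 0" "n > 0"
  obtains \<sigma> where "multi_index m \<sigma>" "mabs m \<sigma> = N" "vars_le m n (\<sigma>, n - 1) = {u \<in> idx m n. level m u \<le> N}"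
proof
  define \<sigma> :: "nat \<Rightarrow> nat" where "\<sigma> = (\<lambda>j. if j = 0 then N else 0)"
  show \<sigma>: "multi_index m \<sigma>" using assms unfolding multi_index_def \<sigma>_def by auto
  show N: "mabs m \<sigma> = N" using assms unfolding mabs_def \<sigma>_def by (simp add: sum.delta)
  have s: "(\<sigma>, n - 1) \<in> idx m n" using \<sigma> assms unfolding idx_def by auto
  have "tri_le m u (\<sigma>, n - 1)" if u: "u \<in> idx m n" "level m u \<le> N" for u
  proof (rule ccontr)
    assume "\<not> ?thesis"
    then have *: "lexordp (<) (ord_key m (\<sigma>, n - 1)) (ord_key m u)"
      using lexordp_total[of "ord_key m (\<sigma>, n - 1)" "ord_key m u"] unfolding tri_le_def by auto
    have "snd u < n" using u unfolding idx_def by auto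
    then have *: "mabs m (fst u) = N" "lexordp (<) (map \<sigma> [0..<m-1]) (map (fst u) [0..<m-1])"
      using * u N unfolding ord_key_def level_def by (auto simp: lexordp_iff)
    \<comment> \<open>Level and k tie, so the strict comparison is decided by a listed
      coordinate.\<close>
    then have "m - 1 > 0" by (cases "m - 1") (auto simp: lexordp_iff)
    then obtain p where p: "m - 1 = Suc p" by (cases "m - 1") auto
    have map: "map f [0..<m-1] = f 0 # map f [1..<m-1]" for f :: "nat \<Rightarrow> nat"
      unfolding p by (subst upt_conv_Cons) auto
    \<comment> \<open>No coordinate exceeds the level; so coordinate 0 ties at N, and the rest of
      \<open>u\<close> vanishes.\<close>
    have le0: "fst u 0 \<le> N" using * member_le_sum[of 0 "{..<m}" "fst u"] assms unfolding mabs_def by auto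
    then have u0: "fst u 0 = N" "lexordp (<) (map \<sigma> [1..<m-1]) (map (fst u) [1..<m-1])"
      using *(2) unfolding map by (auto simp: lexordp_iff \<sigma>_def)
    have "fst u i = \<sigma> i" if "i < m" for i
    proof (cases "i = 0")
      case False
      have "fst u 0 + fst u i \<le> mabs m (fst u)"
        using sum_mono2[of "{..<m}" "{0, i}" "fst u"] that False unfolding mabs_def by auto
      then show ?thesis using u0 *(1) False by (simp add: \<sigma>_def)
    qed (simp add: u0 \<sigma>_def)
    then have eq: "map (fst u) [1..<m-1] = map \<sigma> [1..<m-1]" by auto
    show False using u0(2) lexordp_irrefl unfolding eq by blast
  qed
  then show "vars_le m n (\<sigma>, n - 1) = {u \<in> idx m n. level m u \<le> N}"
    using N tri_le_level[of m _ "(\<sigma>, n - 1)"] unfolding vars_le_eq level_def by auto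
qed

section \<open>Leaders up to level s\<close>

definition affine_span :: "'a::field set \<Rightarrow> ('v \<Rightarrow> 'a) \<Rightarrow> 'v set \<Rightarrow> 'a set" where
  "affine_span L a W = {c0 + (\<Sum>w\<in>W. c w * a w) |c0 c. c0 \<in> L \<and> (\<forall>w. c w \<in> L)}"

lemma affine_spanI: "c0 \<in> L \<Longrightarrow> (\<And>w. c w \<in> L) \<Longrightarrow> y = c0 + (\<Sum>w\<in>W. c w * a w) \<Longrightarrow> y \<in> affine_span L a W"
  unfolding affine_span_def by blast

lemma affine_span_base: "is_subfield L \<Longrightarrow> x \<in> L \<Longrightarrow> x \<in> affine_span L a W"
  by (rule affine_spanI[of x L "\<lambda>_. 0"]) (auto intro: is_subfieldD)

lemma affine_span_gen:
  assumes "is_subfield L" "finite W" "w \<in> W"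
  shows "a w \<in> affine_span L a W"
proof (rule affine_spanI[of 0 L "\<lambda>v. if v = w then 1 else 0"])
  have "(\<Sum>v\<in>W. (if v = w then 1 else 0) * a v) = (\<Sum>v\<in>W. if v = w then a v else 0)"
    by (rule sum.cong) auto
  then show "a w = 0 + (\<Sum>v\<in>W. (if v = w then 1 else 0) * a v)"
    using assms(2,3) by (simp add: sum.delta)
qed (auto intro: is_subfieldD[OF assms(1)])

lemma affine_span_subset: "is_subfield F \<Longrightarrow> L \<subseteq> F \<Longrightarrow> a ` W \<subseteq> F \<Longrightarrow> affine_span L a W \<subseteq> F"
  unfolding affine_span_def by (auto intro!: is_subfieldD(3,4) subfield_sum)

lemma submodule_affine_span:
  assumes "is_subfield L"
  shows "field_map.submodule id L (affine_span L a W)"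
  unfolding field_map.submodule_def[OF field_map_id]
proof (intro conjI ballI)
  note L = is_subfieldD[OF assms]
  show "0 \<in> affine_span L a W" using L by (intro affine_span_base[OF assms])
  fix x assume "x \<in> affine_span L a W"
  then obtain c0 c where c: "c0 \<in> L" "\<And>w. c w \<in> L" "x = c0 + (\<Sum>w\<in>W. c w * a w)" unfolding affine_span_def by blast
  show "id r * x \<in> affine_span L a W" if "r \<in> L" for r
    using c L(4) that by (intro affine_spanI[of "r * c0" L "\<lambda>w. r * c w"]) (auto simp: distrib_left sum_distrib_left mult.assoc)
  fix y assume "y \<in> affine_span L a W"
  then obtain e0 e where e: "e0 \<in> L" "\<And>w. e w \<in> L" "y = e0 + (\<Sum>w\<in>W. e w * a w)" unfolding affine_span_def by blast
  show "x + y \<in> affine_span L a W"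
    using c e L(3) by (intro affine_spanI[of "c0 + e0" L "\<lambda>w. c w + e w"]) (auto simp: distrib_right sum.distrib)
qed

lemma separably_algebraic_member:
  assumes "is_subfield F" "x \<in> F"
  shows "separably_algebraic F x"
  unfolding separably_algebraic_def is_min_poly_def
proof (intro exI[of _ "[:- x, 1:]"] conjI allI impI)
  show "coeff [:- x, 1:] i \<in> F" for i
    using is_subfieldD[OF assms(1)] assms(2) by (cases i; cases "i - 1") (auto simp: coeff_pCons split: nat.split)
  show "degree [:- x, 1:] \<le> degree q" if "q \<noteq> 0 \<and> (\<forall>i. coeff q i \<in> F) \<and> poly q x = 0" for q
    using that by (cases "degree q") (auto elim: degree_eq_zeroE)
  show "coprime [:- x, 1:] (pderiv [:- x, 1:])" by (simp add: pderiv_pCons flip: one_pCons)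
qed auto

context field_map begin

text \<open>Members of W outside the affine span of their predecessors are affinely independent over L,
  so they may be sent to arbitrary values.\<close>
lemma affine_lift:
  fixes r :: "'v \<Rightarrow> nat" and x :: "'v \<Rightarrow> 'e"
  assumes L: "is_subfield L" and W: "finite W" "inj_on r W"
  shows "\<exists>b. (\<forall>v\<in>W. a v \<notin> affine_span L a {w \<in> W. r w < r v} \<longrightarrow> b v = x v) \<and>
    (\<forall>v\<in>W. a v \<in> affine_span L a {w \<in> W. r w < r v} \<longrightarrow>
       b v \<in> gen_field (\<iota> ` L) (x ` {w \<in> W. r w < r v \<and> a w \<notin> affine_span L a {w' \<in> W. r w' < r w}})) \<and>
    (\<forall>c0\<in>L. \<forall>c. (\<forall>w. c w \<in> L) \<longrightarrow> c0 + (\<Sum>w\<in>W. c w * a w) = 0 \<longrightarrow> \<iota> c0 + (\<Sum>w\<in>W. \<iota> (c w) * b w) = 0)"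
  using W
\<comment> \<open>Members enter in increasing rank, so the predecessors of the newcomer are exactly
  the earlier members.\<close>
proof (induction W rule: finite_ranking_induct[where f = r])
  case (insert v W)
  show ?case
  proof (cases "v \<in> W")
    case True
    then show ?thesis using insert by (simp add: insert_absorb)
  next
    case False
    have less: "r w < r v" if "w \<in> W" for w
      using insert.hyps(2)[OF that] inj_onD[OF insert.prems, of w v] False that by fastforce
    have pre_v: "{w \<in> insert v W. r w < r v} = W" using less by auto
    have pre_w: "{w' \<in> insert v W. r w' < r w} = {w' \<in> W. r w' < r w}" if "w \<in> W" for w
      using less[OF that] by auto
    let ?N = "{w \<in> W. a w \<notin> affine_span L a {w' \<in> W. r w' < r w}}"
    have N_v: "{w \<in> insert v W. r w < r v \<and> a w \<notin> affine_span L a {w' \<in> insert v W. r w' < r w}} = ?N"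
      using less pre_w by auto
    have N_w: "{w' \<in> insert v W. r w' < r w \<and> a w' \<notin> affine_span L a {w'' \<in> insert v W. r w'' < r w'}}
      = {w' \<in> W. r w' < r w \<and> a w' \<notin> affine_span L a {w'' \<in> W. r w'' < r w'}}" if "w \<in> W" for w
      using less[OF that] pre_w by auto
    obtain b where free: "\<And>w. w \<in> W \<Longrightarrow> a w \<notin> affine_span L a {w' \<in> W. r w' < r w} \<Longrightarrow> b w = x w"
      and bound: "\<And>w. w \<in> W \<Longrightarrow> a w \<in> affine_span L a {w' \<in> W. r w' < r w} \<Longrightarrow>
       b w \<in> gen_field (\<iota> ` L) (x ` {w' \<in> W. r w' < r w \<and> a w' \<notin> affine_span L a {w'' \<in> W. r w'' < r w'}})"
      and rel: "\<And>c0 c. c0 \<in> L \<Longrightarrow> (\<And>w. c w \<in> L) \<Longrightarrow> c0 + (\<Sum>w\<in>W. c w * a w) = 0 \<Longrightarrow> \<iota> c0 + (\<Sum>w\<in>W. \<iota> (c w) * b w) = 0"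
      using insert.IH[OF inj_on_subset[OF insert.prems subset_insertI]] by (elim exE conjE) blast
    have all: "b w \<in> gen_field (\<iota> ` L) (x ` ?N)" if "w \<in> W" for w
    proof (cases "a w \<in> affine_span L a {w' \<in> W. r w' < r w}")
      case True
      show ?thesis by (rule subsetD[OF gen_field_mono bound[OF that True]]) auto
    next
      case False
      then show ?thesis using free that gen_field_gens[of "x ` ?N"] by force
    qed
    note LL = is_subfieldD[OF L]
    note G = is_subfieldD[OF subfield_gen_field[of "\<iota> ` L" "x ` ?N"]]
    have upd: "(\<Sum>w\<in>W. e w * (b(v := y)) w) = (\<Sum>w\<in>W. e w * b w)" for e y
      using False by (intro sum.cong) auto
    \<comment> \<open>Whatever value \<open>y\<close> the newcomer gets, earlier values are kept;
      only the conditions involving \<open>v\<close> remain.\<close>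
    have combine: ?thesis
      if "a v \<notin> affine_span L a W \<Longrightarrow> y = x v"
        "a v \<in> affine_span L a W \<Longrightarrow> y \<in> gen_field (\<iota> ` L) (x ` ?N)"
        "\<And>e0 e. e0 \<in> L \<Longrightarrow> (\<And>w. e w \<in> L) \<Longrightarrow> e0 + (\<Sum>w\<in>insert v W. e w * a w) = 0 \<Longrightarrow>
          \<iota> e0 + (\<Sum>w\<in>insert v W. \<iota> (e w) * (b(v := y)) w) = 0" for y
    proof (intro exI[of _ "b(v := y)"] conjI ballI impI allI)
      fix w assume w: "w \<in> insert v W"
      show "(b(v := y)) w = x w" if "a w \<notin> affine_span L a {w' \<in> insert v W. r w' < r w}"
      proof (cases "w = v")
        case True
        then show ?thesis using that \<open>a v \<notin> _ \<Longrightarrow> y = x v\<close> unfolding True pre_v by simp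
      next
        case False
        then have wW: "w \<in> W" using w by simp
        then show ?thesis using that free[OF wW] False unfolding pre_w[OF wW] by simp
      qed
      show "(b(v := y)) w \<in> gen_field (\<iota> ` L)
          (x ` {w' \<in> insert v W. r w' < r w \<and> a w' \<notin> affine_span L a {w'' \<in> insert v W. r w'' < r w'}})"
        if "a w \<in> affine_span L a {w' \<in> insert v W. r w' < r w}"
      proof (cases "w = v")
        case True
        then show ?thesis using that \<open>a v \<in> _ \<Longrightarrow> y \<in> _\<close> unfolding True pre_v N_v by simp
      next
        case False
        then have wW: "w \<in> W" using w by simp
        then show ?thesis using that bound[OF wW] False unfolding pre_w[OF wW] N_w[OF wW] by simp
      qed
    qed (use that(3) in blast)
    show ?thesis
    proof (cases "a v \<in> affine_span L a W")
      case True
      then obtain c0 c where c: "c0 \<in> L" "\<And>w. c w \<in> L" "a v = c0 + (\<Sum>w\<in>W. c w * a w)" unfolding affine_span_def by blast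
      \<comment> \<open>The affine expression of \<open>a v\<close>, carried over with each
        \<open>a w\<close> replaced by \<open>b w\<close>.\<close>
      let ?y = "\<iota> c0 + (\<Sum>w\<in>W. \<iota> (c w) * b w)"
      let ?b = "b(v := ?y)"
      have "?y \<in> gen_field (\<iota> ` L) (x ` ?N)"
        using c(1,2) all gen_field_base[of "\<iota> ` L" "x ` ?N"]
        by (intro G(3) subfield_sum[OF subfield_gen_field] G(4)) auto
      moreover have "\<iota> e0 + (\<Sum>w\<in>insert v W. \<iota> (e w) * ?b w) = 0"
        if e: "e0 \<in> L" "\<And>w. e w \<in> L" "e0 + (\<Sum>w\<in>insert v W. e w * a w) = 0" for e0 e
      proof -
        \<comment> \<open>Eliminating \<open>a v\<close> turns the relation into one among the
          earlier members.\<close>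
        have "(e0 + e v * c0) + (\<Sum>w\<in>W. (e w + e v * c w) * a w) = 0"
          using e(3) False insert.hyps(1) unfolding sum.insert[OF insert.hyps(1) False] c(3)
          by (simp add: algebra_simps sum.distrib sum_distrib_left)
        then have "\<iota> (e0 + e v * c0) + (\<Sum>w\<in>W. \<iota> (e w + e v * c w) * b w) = 0"
          using e c LL by (intro rel) auto
        then show ?thesis
          unfolding sum.insert[OF insert.hyps(1) False] upd
          by (simp add: algebra_simps sum.distrib sum_distrib_left)
      qed
      ultimately have new: "?b v \<in> gen_field (\<iota> ` L) (x ` ?N)"
        "\<And>e0 e. e0 \<in> L \<Longrightarrow> (\<And>w. e w \<in> L) \<Longrightarrow> e0 + (\<Sum>w\<in>insert v W. e w * a w) = 0 \<Longrightarrow>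
          \<iota> e0 + (\<Sum>w\<in>insert v W. \<iota> (e w) * ?b w) = 0" by simp_all
      show ?thesis
        by (rule combine[of ?y]) (use True new in simp_all)
    next
      case notin: False
      let ?b = "b(v := x v)"
      have "\<iota> e0 + (\<Sum>w\<in>insert v W. \<iota> (e w) * ?b w) = 0"
        if e: "e0 \<in> L" "\<And>w. e w \<in> L" "e0 + (\<Sum>w\<in>insert v W. e w * a w) = 0" for e0 e
      proof -
        \<comment> \<open>A nonzero coefficient would place \<open>a v\<close> in the affine span of
          its predecessors.\<close>
        have ev: "e v = 0"
        proof (rule ccontr)
          assume nz: "e v \<noteq> 0"
          have "e v * a v = - (e0 + (\<Sum>w\<in>W. e w * a w))"
            using e(3) unfolding sum.insert[OF insert.hyps(1) False] by (simp add: eq_neg_iff_add_eq_0 algebra_simps)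
          then have "a v = - (e0 + (\<Sum>w\<in>W. e w * a w)) / e v" using nz by (simp add: field_simps)
          also have "\<dots> = - (e0 / e v) + (\<Sum>w\<in>W. - (e w / e v) * a w)"
            by (simp add: add_divide_distrib diff_divide_distrib sum_divide_distrib sum_negf)
          finally have "a v \<in> affine_span L a W"
            using e LL by (intro affine_spanI[of "- (e0 / e v)" L "\<lambda>w. - (e w / e v)"]) auto
          then show False using notin by blast
        qed
        then have "\<iota> e0 + (\<Sum>w\<in>W. \<iota> (e w) * b w) = 0"
          using e unfolding sum.insert[OF insert.hyps(1) False] by (intro rel) auto
        then show ?thesis unfolding sum.insert[OF insert.hyps(1) False] upd using ev by simp
      qed
      then show ?thesis
        by (intro combine[of "x v"]) (use notin in simp_all)
    qed
  qed
qed auto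

end

text \<open>\<open>\<mu>_pos\<close> guarantees that s - 1 is a level; degree 0 is settled
  separately, with a copy of \<open>K\<close> as the extension.\<close>

locale diff_cond =
  fixes m n :: nat and \<mu> :: "nat \<Rightarrow> nat" and K :: "'a::field set" and d :: "nat \<Rightarrow> 'a \<Rightarrow> 'a"
    and a :: "(nat \<Rightarrow> nat) \<times> nat \<Rightarrow> 'a"
  assumes m: "m > 0" and n: "n > 0" and K: "diff_field m K d" and cond: "differential_condition m n \<mu> K d a"
    and \<mu>_pos: "mabs m \<mu> > 0"
begin

abbreviation "I \<equiv> idx m n"
abbreviation "lv \<equiv> level m"
abbreviation "rk \<equiv> rank m n"
abbreviation "s \<equiv> mabs m \<mu>"

definition "L = gen_field K (a ` {u \<in> I. lv u < s})"
definition "W = {u \<in> I. lv u = s}"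
text \<open>At level s this takes the place of separability: a generator of level s that is
  separably algebraic but not of this form will be made free.\<close>

definition "linear_leader v \<longleftrightarrow> a v \<in> affine_span L a {w \<in> W. rk w < rk v}"
definition "lower_field v = gen_field K (a ` {u \<in> I. rk u < rk v})"

abbreviation "leader v \<equiv> separably_algebraic (lower_field v) (a v)"

lemma leader_iff: "v \<in> I \<Longrightarrow> leader v \<longleftrightarrow> separable_leader m n K a (fst v) (snd v)"
  unfolding separable_leader_def lower_field_def by (simp add: vars_less_rank[OF m])

lemma K_subfield: "is_subfield K" and d_closed: "i < m \<Longrightarrow> x \<in> K \<Longrightarrow> d i x \<in> K"
  using K unfolding diff_field_def is_derivation_def by auto

lemma L_subfield: "is_subfield L" unfolding L_def by (rule subfield_gen_field)

lemma K_L: "K \<subseteq> L" unfolding L_def by (rule gen_field_base)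

lemma a_L: "u \<in> I \<Longrightarrow> lv u < s \<Longrightarrow> a u \<in> L"
  unfolding L_def by (rule subsetD[OF gen_field_gens]) auto

lemma W_finite: "finite W"
  unfolding W_def by (rule finite_subset[OF _ finite_idx_level[of m n s]]) auto

lemma W_inj: "inj_on rk W"
  unfolding W_def by (rule inj_onI) (rule rank_inj[OF m], auto)

text \<open>For a vanishing polynomial in the generators of \<open>L\<close>, the differential
  condition gives an identity in the \<open>a (shift i v)\<close>. Only the \<open>v\<close> of
  level s - 1 lead to level s, so this is an affine relation over \<open>L\<close> among the
  generators in \<open>W\<close>, and \<open>b\<close> respects it. The choice \<open>b = a\<close>
  gives derivations into the given field itself.\<close>

lemma level_derivation:
  fixes \<iota> :: "'a \<Rightarrow> 'e::field" and b :: "(nat \<Rightarrow> nat) \<times> nat \<Rightarrow> 'e"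
  assumes "field_map \<iota>" and i: "i < m"
    and b_low: "\<And>u. u \<in> I \<Longrightarrow> lv u < s \<Longrightarrow> b u = \<iota> (a u)"
    and rel: "\<And>c0 c. c0 \<in> L \<Longrightarrow> (\<And>w. c w \<in> L) \<Longrightarrow> c0 + (\<Sum>w\<in>W. c w * a w) = 0 \<Longrightarrow> \<iota> c0 + (\<Sum>w\<in>W. \<iota> (c w) * b w) = 0"
  obtains D where "field_map.deriv_on \<iota> L D" "\<And>x. x \<in> K \<Longrightarrow> D x = \<iota> (d i x)"
    "\<And>u. u \<in> I \<Longrightarrow> lv u < s \<Longrightarrow> D (a u) = b (shift i u)"
proof -
  interpret field_map \<iota> by fact
  note LL = is_subfieldD[OF L_subfield]
  let ?V = "{u \<in> I. lv u < s}"
  let ?Vlow = "{u \<in> I. Suc (lv u) < s}"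
  let ?Vtop = "{u \<in> I. Suc (lv u) = s}"
  have fin: "finite ?V"
    by (rule finite_subset[OF _ finite_idx_level[of m n s]]) auto
  have V: "?V = ?Vlow \<union> ?Vtop" "?Vlow \<inter> ?Vtop = {}" by auto
  have fin': "finite ?Vlow" "finite ?Vtop" by (auto intro: finite_subset[OF _ fin])
  \<comment> \<open>Level s - 1 is the highest to which the condition applies; its greatest index
    has all generators of \<open>L\<close> as variables.\<close>
  obtain \<sigma> where \<sigma>: "multi_index m \<sigma>" "mabs m \<sigma> = s - 1" "vars_le m n (\<sigma>, n - 1) = {u \<in> idx m n. level m u \<le> s - 1}"
    using level_eq_vars_le[OF m n] by blast
  have vars: "vars_le m n (\<sigma>, n - 1) = ?V" unfolding \<sigma>(3) using \<mu>_pos by auto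
  have \<delta>: "deriv_on K (\<lambda>x. \<iota> (d i x))"
    using K i unfolding deriv_on_def diff_field_def is_derivation_def by auto
  show thesis
  proof (rule deriv_extension[OF K_subfield \<delta>, of ?V a "\<lambda>u. b (shift i u)"])
    fix f assume f: "mpoly_over K ?V f" "mpoly_eval f a = 0"
    define p where "p v = mpoly_pderiv_eval f v a" for v
    have mon: "monom_val t a \<in> L" if "t \<in> Poly_Mapping.keys f" for t
      using f(1) that unfolding monom_val_def mpoly_over_def
      by (intro subfield_prod[OF L_subfield] LL(9) a_L) auto
    have p: "p v \<in> L" if "v \<in> I" "lv v < s" for v
      using f(1) a_L[OF that] K_L unfolding p_def mpoly_pderiv_eval_def mpoly_over_def
      by (intro subfield_sum[OF L_subfield] LL(4) subfield_prod[OF L_subfield] LL(9) subfield_of_nat[OF L_subfield]) (auto intro!: a_L)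
    define e where "e = mpoly_coeffmap_eval (d i) f a"
    have e: "e \<in> L" unfolding e_def mpoly_coeffmap_eval_def
      using f(1) K_L unfolding mpoly_over_def by (intro subfield_sum[OF L_subfield] LL(4) mon) (blast intro: d_closed[OF i])+
    have "(\<Sum>(\<eta>, g)\<in>?V. mpoly_pderiv_eval f (\<eta>, g) a * a (madd \<eta> (eps i), g)) + e = 0"
      unfolding e_def vars[symmetric]
    proof (rule cond[unfolded differential_condition_def, rule_format, of i "n - 1" \<sigma> f], intro conjI)
      show "mpoly_over K (vars_le m n (\<sigma>, n - 1)) f" unfolding vars by (rule f(1))
    qed (use i n \<sigma>(1,2) f(2) \<mu>_pos in auto)
    also have "(\<Sum>(\<eta>, g)\<in>?V. mpoly_pderiv_eval f (\<eta>, g) a * a (madd \<eta> (eps i), g)) = (\<Sum>v\<in>?V. p v * a (shift i v))"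
      unfolding p_def shift_def by (rule sum.cong) auto
    finally have 0: "(\<Sum>v\<in>?V. p v * a (shift i v)) + e = 0" .
    \<comment> \<open>The coefficient at w is the partial derivative at the only \<open>v\<close> of
      level s - 1 with \<open>shift i v = w\<close>, and 0 if there is none.\<close>
    define c where "c w = (if w \<in> shift i ` ?Vtop then p (the_inv (shift i) w) else 0)" for w
    have inj: "inj (shift i)" by (auto intro: injI shift_inj)
    \<comment> \<open>Stated for a map \<open>h\<close> on coefficients, because it serves once with
      the identity and once with \<open>\<iota>\<close>.\<close>
    have cW: "(\<Sum>w\<in>W. h (c w) * g w) = (\<Sum>v\<in>?Vtop. h (p v) * g (shift i v))" if "h 0 = 0"
      for g :: "_ \<Rightarrow> 'b::field" and h
    proof -
      have "(\<Sum>w\<in>W. h (c w) * g w) = (\<Sum>w\<in>shift i ` ?Vtop. h (c w) * g w)"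
        using W_finite i that by (intro sum.mono_neutral_right) (auto simp: W_def c_def shift_idx level_shift)
      also have "\<dots> = (\<Sum>v\<in>?Vtop. h (c (shift i v)) * g (shift i v))"
        using inj by (subst sum.reindex) (auto simp: inj_on_def)
      also have "\<dots> = (\<Sum>v\<in>?Vtop. h (p v) * g (shift i v))"
        by (rule sum.cong) (auto simp: c_def the_inv_f_f[OF inj])
      finally show ?thesis .
    qed
    define c0 where "c0 = (\<Sum>v\<in>?Vlow. p v * a (shift i v)) + e"
    have split: "(\<Sum>v\<in>?V. g v) = (\<Sum>v\<in>?Vlow. g v) + (\<Sum>v\<in>?Vtop. g v)" for g :: "_ \<Rightarrow> 'b::field"
      unfolding V(1) by (rule sum.union_disjoint[OF fin' V(2)])
    have "\<iota> c0 + (\<Sum>w\<in>W. \<iota> (c w) * b w) = 0"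
    proof (rule rel)
      show "c0 \<in> L" unfolding c0_def using p e i
        by (intro LL(3) subfield_sum[OF L_subfield] LL(4)) (auto intro!: a_L simp: shift_idx level_shift)
      show "c w \<in> L" for w unfolding c_def using p LL(1) by (auto simp: the_inv_f_f[OF inj])
      show "c0 + (\<Sum>w\<in>W. c w * a w) = 0"
        using 0 cW[of "\<lambda>x. x" a] unfolding c0_def split by (simp add: algebra_simps)
    qed
    moreover have "(\<Sum>v\<in>?Vlow. \<iota> (p v) * b (shift i v)) = (\<Sum>v\<in>?Vlow. \<iota> (p v) * \<iota> (a (shift i v)))"
      using b_low i by (intro sum.cong) (auto simp: shift_idx level_shift)
    ultimately have "(\<Sum>v\<in>?V. \<iota> (p v) * b (shift i v)) + \<iota> e = 0"
      using cW[of \<iota> b] unfolding c0_def split by (simp add: algebra_simps)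
    then show "mpoly_deriv (\<lambda>x. \<iota> (d i x)) a (\<lambda>u. b (shift i u)) f = 0"
      unfolding mpoly_deriv_eq[OF fin f(1)] p_def e_def mpoly_coeffmap_eval_def by simp
  qed (use that in \<open>auto simp: L_def\<close>)
qed

lemma lower_field_subfield: "is_subfield (lower_field v)"
  unfolding lower_field_def by (rule subfield_gen_field)

lemma lower_field_in_L: "v \<in> I \<Longrightarrow> lv v < s \<Longrightarrow> lower_field v \<subseteq> L"
  unfolding lower_field_def
proof (rule gen_field_least[OF L_subfield K_L])
  assume v: "v \<in> I" "lv v < s"
  show "a ` {u \<in> I. rk u < rk v} \<subseteq> L"
  proof (rule image_subsetI)
    fix u assume "u \<in> {u \<in> I. rk u < rk v}"
    then show "a u \<in> L" using rank_level[OF m _ v(1), of u] v by (intro a_L) auto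
  qed
qed

lemma L_lower_field: "v \<in> I \<Longrightarrow> s \<le> lv v \<Longrightarrow> L \<subseteq> lower_field v"
  unfolding lower_field_def L_def by (intro gen_field_mono image_mono) (auto intro: level_rank[OF m])

lemma linear_leader_leader: "v \<in> W \<Longrightarrow> linear_leader v \<Longrightarrow> leader v"
  using affine_span_subset[OF lower_field_subfield L_lower_field[of v], of a "{w \<in> W. rk w < rk v}"]
    gen_field_gens[of "a ` {u \<in> I. rk u < rk v}" K]
  unfolding linear_leader_def W_def by (intro separably_algebraic_member[OF lower_field_subfield]) (auto simp: lower_field_def)

text \<open>The derivation of \<open>L\<close> turns the separable equation of \<open>a u\<close>
  into a linear one for \<open>a (shift i u)\<close>, in terms of derivatives of predecessors of u,
  which precede \<open>shift i u\<close>. Below level s these lie in the lower field, at level s in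
  the affine span.\<close>

lemma leader_shift:
  assumes u: "u \<in> I" "lv u < s" "leader u" and i: "i < m"
  shows "if lv (shift i u) < s then leader (shift i u) else linear_leader (shift i u)"
proof -
  interpret field_map "id :: 'a \<Rightarrow> 'a" by (rule field_map_id)
  obtain D where D: "deriv_on L D" "\<And>x. x \<in> K \<Longrightarrow> D x = id (d i x)"
    "\<And>u. u \<in> I \<Longrightarrow> lv u < s \<Longrightarrow> D (a u) = a (shift i u)"
    by (rule level_derivation[OF field_map_id i, of a]) auto
  let ?v = "shift i u"
  have v: "?v \<in> I" using u i by (auto simp: shift_idx)
  have low: "w \<in> I" "lv w < s" "shift i w \<in> I" "rk (shift i w) < rk ?v" if "w \<in> I" "rk w < rk u" for w
    using rank_level[OF m that(1) u(1)] u that i by (auto simp: shift_idx rank_shift_mono[OF m])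
  \<comment> \<open>One argument for two modules: the lower field of \<open>?v\<close> below level
    s, and an affine span over \<open>L\<close> at level s.\<close>
  have main: "D (a u) \<in> T" if R: "is_subfield R" "lower_field u \<subseteq> R" "a u \<in> R" and T: "submodule R T" "K \<subseteq> T"
    and aT: "\<And>w. w \<in> I \<Longrightarrow> rk w < rk u \<Longrightarrow> a (shift i w) \<in> T" for R T
  proof -
    have "D ` lower_field u \<subseteq> T" unfolding lower_field_def
    proof (rule deriv_gen_field_into[OF L_subfield D(1) _ _ T(1)])
      show "gen_field K (a ` {w \<in> I. rk w < rk u}) \<subseteq> L" "gen_field K (a ` {w \<in> I. rk w < rk u}) \<subseteq> R"
        using lower_field_in_L[OF u(1,2)] R(2) unfolding lower_field_def by auto
      show "D ` K \<subseteq> T" using D(2) d_closed[OF i] T(2) by auto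
      show "D ` a ` {w \<in> I. rk w < rk u} \<subseteq> T" using D(3) low aT by auto
    qed
    then show ?thesis
      by (rule deriv_separable_into[OF L_subfield D(1) u(3) a_L[OF u(1,2)] lower_field_in_L[OF u(1,2)] R T(1)])
  qed
  show ?thesis
  proof (cases "lv ?v < s")
    case True
    have sub: "lower_field u \<subseteq> lower_field ?v"
      unfolding lower_field_def using rank_shift[OF m u(1) i] by (intro gen_field_mono image_mono) auto
    have gens: "a w \<in> lower_field ?v" if "w \<in> I" "rk w < rk ?v" for w
      unfolding lower_field_def by (rule subsetD[OF gen_field_gens]) (use that in auto)
    have aR: "a u \<in> lower_field ?v" by (rule gens[OF u(1) rank_shift[OF m u(1) i]])
    have sm: "submodule (lower_field ?v) (lower_field ?v)"
      unfolding submodule_def using is_subfieldD(1,3,4)[OF lower_field_subfield] by simp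
    have "D (a u) \<in> lower_field ?v"
    proof (rule main[OF lower_field_subfield sub aR sm])
      show "K \<subseteq> lower_field ?v" unfolding lower_field_def by (rule gen_field_base)
      show "a (shift i w) \<in> lower_field ?v" if "w \<in> I" "rk w < rk u" for w
        using gens low(3,4)[OF that] by blast
    qed
    then show ?thesis using True D(3)[OF u(1,2)] separably_algebraic_member[OF lower_field_subfield] by simp
  next
    case False
    let ?P = "{w \<in> W. rk w < rk ?v}"
    have "D (a u) \<in> affine_span L a ?P"
    proof (rule main[OF L_subfield lower_field_in_L[OF u(1,2)] a_L[OF u(1,2)] submodule_affine_span[OF L_subfield]])
      show "K \<subseteq> affine_span L a ?P" using K_L affine_span_base[OF L_subfield] by blast
      fix w assume w: "w \<in> I" "rk w < rk u"
      show "a (shift i w) \<in> affine_span L a ?P"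
      proof (cases "lv (shift i w) < s")
        case True
        then show ?thesis using low[OF w] by (intro affine_span_base[OF L_subfield] a_L)
      next
        case False
        have "lv w < s" using low(2)[OF w] .
        then have "shift i w \<in> ?P" using False low[OF w] i unfolding W_def by (auto simp: level_shift)
        then show ?thesis using W_finite by (intro affine_span_gen[OF L_subfield]) auto
      qed
    qed
    then show ?thesis using False D(3)[OF u(1,2)] unfolding linear_leader_def by simp
  qed
qed

end

section \<open>Generated leaders\<close>

text \<open>Compared in all coordinates, not only those below m; on \<open>idx m n\<close> this is
  the same.\<close>

definition idx_le :: "(nat \<Rightarrow> nat) \<times> nat \<Rightarrow> (nat \<Rightarrow> nat) \<times> nat \<Rightarrow> bool" where
  "idx_le u v \<longleftrightarrow> snd u = snd v \<and> (\<forall>j. fst u j \<le> fst v j)"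

text \<open>The subtraction is truncated, so \<open>shift i\<close> undoes it only where coordinate
  i is positive.\<close>

definition unshift :: "nat \<Rightarrow> (nat \<Rightarrow> nat) \<times> nat \<Rightarrow> (nat \<Rightarrow> nat) \<times> nat" where
  "unshift i u = ((\<lambda>j. fst u j - eps i j), snd u)"

lemma idx_le_refl: "idx_le u u"
  and idx_le_trans: "idx_le u v \<Longrightarrow> idx_le v w \<Longrightarrow> idx_le u w"
  unfolding idx_le_def by (auto intro: order_trans)

lemma idx_le_shift: "idx_le u (shift i u)"
  unfolding idx_le_def shift_def madd_def by auto

lemma unshift_shift [simp]: "unshift i (shift i u) = u"
  unfolding unshift_def shift_def madd_def by auto

lemma shift_unshift: "fst u i > 0 \<Longrightarrow> shift i (unshift i u) = u"
  unfolding unshift_def shift_def madd_def eps_def by (auto simp: prod_eq_iff fun_eq_iff)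

lemma fst_shift: "fst (shift i u) j = fst u j + (if j = i then 1 else 0)"
  unfolding shift_def madd_def eps_def by auto

lemma fst_unshift: "fst (unshift i u) j = fst u j - (if j = i then 1 else 0)"
  unfolding unshift_def eps_def by auto

lemma snd_shift [simp]: "snd (shift i u) = snd u" and snd_unshift [simp]: "snd (unshift i u) = snd u"
  unfolding shift_def unshift_def by auto

lemma unshift_idx: "u \<in> idx m n \<Longrightarrow> unshift i u \<in> idx m n"
  unfolding idx_def unshift_def multi_index_def by auto

lemma idx_le_level:
  assumes "idx_le u v"
  shows "level m u \<le> level m v"
  using assms unfolding idx_le_def level_def mabs_def by (auto intro: sum_mono)

lemma idx_le_eq:
  assumes "u \<in> idx m n" "v \<in> idx m n" "idx_le u v" "level m v \<le> level m u"
  shows "u = v"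
proof -
  have "fst u j = fst v j" for j
  proof (cases "j < m")
    case True
    show ?thesis
    proof (rule ccontr)
      assume "fst u j \<noteq> fst v j"
      then have "fst u j < fst v j" using assms(3) unfolding idx_le_def by (simp add: le_neq_implies_less)
      then have "mabs m (fst u) < mabs m (fst v)" unfolding mabs_def
        using True assms(3) by (intro sum_strict_mono_ex1) (auto simp: idx_le_def)
      then show False using assms(4) unfolding level_def by simp
    qed
  next
    case False
    then show ?thesis using assms(1,2) unfolding idx_def multi_index_def by auto
  qed
  then show ?thesis using assms(3) unfolding idx_le_def by (auto simp: prod_eq_iff)
qed

lemma idx_le_step:
  assumes "u \<in> idx m n" "v \<in> idx m n" "idx_le u v" "level m u < level m v"
  obtains j where "j < m" "idx_le (shift j u) v"
proof -
  have "\<exists>j<m. fst u j < fst v j"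
  proof (rule ccontr)
    assume "\<not> ?thesis"
    then have "mabs m (fst v) \<le> mabs m (fst u)" unfolding mabs_def by (intro sum_mono) (meson lessThan_iff not_less)
    then show False using assms(4) unfolding level_def by simp
  qed
  then obtain j where j: "j < m" "fst u j < fst v j" by blast
  then have "idx_le (shift j u) v" using assms(3) unfolding idx_le_def by (auto simp: fst_shift)
  then show thesis using that j by blast
qed

locale bounded_leaders = diff_cond +
  assumes \<mu>: "multi_index m \<mu>"
    and bounded: "\<And>\<sigma> k. (\<sigma>, k) \<in> gen_idx m n \<mu> \<Longrightarrow> min_separable_leader m n K a \<sigma> k \<Longrightarrow> mle m \<sigma> \<mu>"
begin

definition "low_leader v \<longleftrightarrow> v \<in> I \<and> (lv v < s \<and> leader v \<or> lv v = s \<and> linear_leader v)"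

text \<open>Above level s the relations are to be those generated by the leaders of level at most s:
  separable ones below level s and linear ones at level s.\<close>
definition "lead v \<longleftrightarrow> v \<in> I \<and> (\<exists>u. low_leader u \<and> idx_le u v \<and> (\<forall>j. fst u j \<le> \<mu> j))"

lemma lead_idx: "lead v \<Longrightarrow> v \<in> I"
  unfolding lead_def by blast

text \<open>Among the leaders below v one of least level is a minimal leader, hence bounded by
  \<open>\<mu>\<close>. If its level is below s it is a low leader by definition; otherwise it
  equals v, so linearity at level s is kept.\<close>

lemma low_leader_bounded:
  assumes "low_leader v"
  obtains u where "low_leader u" "idx_le u v" "\<forall>j. fst u j \<le> \<mu> j"
proof -
  have v: "v \<in> I" "lv v \<le> s" "leader v"
    using assms linear_leader_leader[of v] unfolding low_leader_def W_def by auto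
  obtain u where u: "u \<in> I" "idx_le u v" "leader u"
    and min: "\<And>w. w \<in> I \<Longrightarrow> idx_le w v \<Longrightarrow> leader w \<Longrightarrow> lv u \<le> lv w"
    using ex_has_least_nat[of "\<lambda>u. u \<in> I \<and> idx_le u v \<and> leader u" v lv] v idx_le_refl by blast
  have "\<not> separable_leader m n K a \<rho> (snd u)"
    if \<rho>: "multi_index m \<rho>" "mle m \<rho> (fst u)" "\<rho> \<noteq> fst u" for \<rho>
  proof
    assume sl: "separable_leader m n K a \<rho> (snd u)"
    let ?w = "(\<rho>, snd u)"
    have w: "?w \<in> I" using \<rho> u(1) unfolding idx_def by auto
    have "\<rho> j \<le> fst u j" for j
      using \<rho>(1,2) unfolding mle_def multi_index_def by (cases "j < m") auto
    then have le: "idx_le ?w u" unfolding idx_le_def by auto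
    have "lv u \<le> lv ?w" using min[OF w idx_le_trans[OF le u(2)]] leader_iff[OF w] sl by simp
    then have "?w = u" by (rule idx_le_eq[OF w u(1) le])
    then show False using \<rho>(3) by (metis fst_conv)
  qed
  then have "min_separable_leader m n K a (fst u) (snd u)"
    using leader_iff[OF u(1)] u(3) unfolding min_separable_leader_def by blast
  moreover have "lv u \<le> s" using idx_le_level[OF u(2), of m] v(2) by simp
  moreover from this have "(fst u, snd u) \<in> gen_idx m n \<mu>"
    using u(1) unfolding gen_idx_def idx_def level_def by auto
  ultimately have "mle m (fst u) \<mu>" using bounded by blast
  then have "fst u j \<le> \<mu> j" for j
    using u(1) \<mu> unfolding mle_def idx_def multi_index_def by (cases "j < m") auto
  moreover have "low_leader u"
  proof (cases "lv u < s")
    case True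
    then show ?thesis using u unfolding low_leader_def by auto
  next
    case False
    then have "u = v" using idx_le_eq[OF u(1) v(1) u(2)] v(2) by simp
    then show ?thesis using assms by simp
  qed
  ultimately show thesis using that u(2) by blast
qed

text \<open>Climbs from u to v one coordinate step at a time, by
  \<open>leader_shift\<close>.\<close>

lemma low_leader_upward:
  "low_leader u \<Longrightarrow> v \<in> I \<Longrightarrow> idx_le u v \<Longrightarrow> lv v \<le> s \<Longrightarrow> low_leader v"
proof (induction "lv v - lv u" arbitrary: u)
  case 0
  then show ?case using idx_le_eq[of u m n v] unfolding low_leader_def by auto
next
  case (Suc k)
  have u: "u \<in> I" using Suc.prems unfolding low_leader_def by auto
  have lt: "lv u < lv v" using Suc.hyps(2) by simp
  obtain j where j: "j < m" "idx_le (shift j u) v" using idx_le_step[OF u Suc.prems(2,3) lt] .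
  have "lv (shift j u) \<le> s" using idx_le_level[OF j(2), of m] Suc.prems(4) by simp
  then have "low_leader (shift j u)"
    using leader_shift[OF u _ _ j(1)] Suc.prems(1) lt Suc.prems(4) shift_idx[OF u j(1)]
    unfolding low_leader_def by (auto split: if_splits)
  moreover have "k = lv v - lv (shift j u)" using Suc.hyps(2) j(1) by (simp add: level_shift)
  ultimately show ?case using Suc.hyps(1) Suc.prems(2,4) j(2) by blast
qed

text \<open>Up to level s, generating upward adds nothing new, and the bound by \<open>\<mu>\<close>
  excludes nothing.\<close>

lemma lead_iff_low: "v \<in> I \<Longrightarrow> lv v \<le> s \<Longrightarrow> lead v \<longleftrightarrow> low_leader v"
  by (metis lead_def low_leader_bounded low_leader_upward)

lemma lead_upward: "lead u \<Longrightarrow> idx_le u v \<Longrightarrow> v \<in> I \<Longrightarrow> lead v"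
  unfolding lead_def using idx_le_trans by blast

lemma lead_shift: "lead u \<Longrightarrow> i < m \<Longrightarrow> lead (shift i u)"
  by (rule lead_upward[OF _ idx_le_shift shift_idx[OF lead_idx]])

lemma exceeds_\<mu>:
  assumes "lv z > s"
  obtains l where "l < m" "\<mu> l < fst z l"
proof -
  have "\<exists>l<m. \<mu> l < fst z l"
  proof (rule ccontr)
    assume "\<not> ?thesis"
    then have "mabs m (fst z) \<le> mabs m \<mu>" unfolding mabs_def by (intro sum_mono) (meson lessThan_iff not_less)
    then show False using assms unfolding level_def by simp
  qed
  then show thesis using that by blast
qed

text \<open>The generating leader is bounded by \<open>\<mu>\<close>, so where z exceeds
  \<open>\<mu>\<close> there is room for one step down that stays above that leader.\<close>

lemma lead_unshift:
  assumes z: "lead z" and l: "\<mu> l < fst z l"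
  shows "lead (unshift l z)" "shift l (unshift l z) = z"
proof -
  obtain u where u: "low_leader u" "idx_le u z" "\<forall>j. fst u j \<le> \<mu> j" using z unfolding lead_def by blast
  have "fst u l < fst z l" using u(3) l le_less_trans by blast
  then have "idx_le u (unshift l z)" using u(2) unfolding idx_le_def by (auto simp: fst_unshift)
  then show "lead (unshift l z)" unfolding lead_def using u z unshift_idx lead_idx by blast
  show "shift l (unshift l z) = z" using l by (intro shift_unshift) simp
qed

lemma lead_predecessor:
  assumes "lead z" "lv z > s"
  shows "\<exists>j u. j < m \<and> lead u \<and> z = shift j u"
  using exceeds_\<mu>[OF assms(2)] lead_unshift[OF assms(1)] by metis

text \<open>Two leaders below z are linked through leaders whose pairwise meets are leaders. If the direct
  meet is not one, go through a coordinate in which z exceeds \<open>\<mu>\<close>: this is where minimal leaders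
  being bounded by \<open>\<mu>\<close> matters.\<close>
lemma lead_link:
  assumes ij: "i < m" "j < m" and u: "lead u" and v: "lead v" and z: "shift i u = shift j v" "lv (shift i u) > s"
    and ne: "i \<noteq> j"
  obtains (meet) t where "lead t" "u = shift j t" "v = shift i t"
  | (link) l w t t' where "l < m" "shift l w = shift i u" "lead t" "u = shift l t" "w = shift i t"
      "lead t'" "v = shift l t'" "w = shift j t'"
proof -
  let ?z = "shift i u"
  have zI: "?z \<in> I" using shift_idx lead_idx u ij by blast
  obtain l where l: "l < m" "\<mu> l < fst ?z l" using exceeds_\<mu>[OF z(2)] .
  have uj: "fst u j > 0" using arg_cong[OF z(1), of "\<lambda>u. fst u j"] ne by (simp add: fst_shift)
  have vi: "fst v i > 0" using arg_cong[OF z(1), of "\<lambda>u. fst u i"] ne by (simp add: fst_shift split: if_splits)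
  \<comment> \<open>Both are the meet of u and v: z lowered by one at \<open>i\<close> and at
    \<open>j\<close>.\<close>
  have uv: "unshift j u = unshift i v"
  proof -
    have "unshift j u = unshift j (unshift i (shift i u))" by simp
    also have "\<dots> = unshift i (unshift j (shift j v))" unfolding z(1)
      by (simp add: unshift_def add.commute)
    finally show ?thesis by simp
  qed
  show thesis
  proof (cases "l = i \<or> l = j")
    case True
    have "lead (unshift j u)"
    proof (cases "l = i")
      case True
      have "\<mu> l < fst v l" using l(2) True ne unfolding z(1) by (simp add: fst_shift)
      then show ?thesis using lead_unshift(1)[OF v] uv True by simp
    next
      case False
      then have "l = j" using \<open>l = i \<or> l = j\<close> by simp
      then have "\<mu> l < fst u l" using l(2) ne by (simp add: fst_shift)
      then show ?thesis using lead_unshift(1)[OF u] \<open>l = j\<close> by simp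
    qed
    moreover have "u = shift j (unshift j u)" "v = shift i (unshift j u)"
      using shift_unshift[of u j] shift_unshift[of v i] uj vi unfolding uv by simp_all
    ultimately show thesis by (rule meet)
  next
    case False
    \<comment> \<open>Here u and v both exceed \<open>\<mu>\<close> at l, so both may be lowered
      there. The linking w is z lowered at l; its meets with u and with v are these lowered
      leaders.\<close>
    have lu: "\<mu> l < fst u l" and lvv: "\<mu> l < fst v l"
      using l(2) False unfolding z(1) by (simp_all add: fst_shift) (use l(2) False in \<open>simp add: fst_shift\<close>)
    note U = lead_unshift[OF u lu] and V = lead_unshift[OF v lvv]
    have w: "shift l (unshift l ?z) = ?z" using l(2) by (intro shift_unshift) simp
    have "unshift l ?z = shift i (unshift l u)"
      using unshift_shift[of l "shift i (unshift l u)"] U(2) by (simp add: shift_commute[of l i])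
    moreover have "unshift l ?z = shift j (unshift l v)"
      using unshift_shift[of l "shift j (unshift l v)"] V(2) unfolding z(1) by (simp add: shift_commute[of l j])
    ultimately show thesis using link[OF l(1) w U(1) _ _ V(1)] U(2) V(2) by simp
  qed
qed

end

section \<open>The free extension\<close>

text \<open>\<open>X\<close> supplies variables independent over the image of \<open>'a\<close>, and
  \<open>b0\<close> the replaced generators up to level s. \<open>\<delta> i\<close> is defined on
  \<open>L\<close> with values in \<open>'e\<close>, since it sends level s - 1 to the replaced
  level s. \<open>b0_lead\<close> keeps a dependent generator in the field of the earlier free
  ones.\<close>

locale free_extension = bounded_leaders m n \<mu> K d a + field_map \<iota>
  for m n :: nat and \<mu> and K :: "'a::field set" and d and a and \<iota> :: "'a \<Rightarrow> 'e::field" +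
  fixes X :: "(nat \<Rightarrow> nat) \<times> nat \<Rightarrow> 'e" and b0 :: "(nat \<Rightarrow> nat) \<times> nat \<Rightarrow> 'e" and \<delta> :: "nat \<Rightarrow> 'a \<Rightarrow> 'e"
  assumes X_indep: "\<And>f. mpoly_over (range \<iota>) I f \<Longrightarrow> mpoly_eval f X = 0 \<Longrightarrow> f = 0"
    and b0_low: "\<And>u. u \<in> I \<Longrightarrow> lv u < s \<Longrightarrow> b0 u = \<iota> (a u)"
    and b0_free: "\<And>v. v \<in> W \<Longrightarrow> \<not> linear_leader v \<Longrightarrow> b0 v = X v"
    and b0_lead: "\<And>v. v \<in> W \<Longrightarrow> linear_leader v \<Longrightarrow>
      b0 v \<in> gen_field (\<iota> ` L) (X ` {w \<in> W. rk w < rk v \<and> \<not> linear_leader w})"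
    and \<delta>_deriv: "\<And>i. i < m \<Longrightarrow> deriv_on L (\<delta> i)"
    and \<delta>_K: "\<And>i x. i < m \<Longrightarrow> x \<in> K \<Longrightarrow> \<delta> i x = \<iota> (d i x)"
    and \<delta>_a: "\<And>i u. i < m \<Longrightarrow> u \<in> I \<Longrightarrow> lv u < s \<Longrightarrow> \<delta> i (a u) = b0 (shift i u)"
begin

sublocale E: field_map "id :: 'e \<Rightarrow> 'e" by (rule field_map_id)

text \<open>The variables actually adjoined: \<open>S\<close> below is purely transcendental over
  the image of \<open>L\<close>, with these as a basis.\<close>

definition "N = {u \<in> I. s \<le> lv u \<and> \<not> lead u}"
definition "S = gen_field (\<iota> ` L) (X ` N)"
text \<open>The counterpart of \<open>lower_field\<close> in the extension, except that it always
  contains the image of \<open>L\<close>.\<close>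

definition "below v = gen_field (\<iota> ` L) (X ` {u \<in> N. rk u < rk v})"

lemma S_subfield: "is_subfield S" and below_subfield: "is_subfield (below v)"
  unfolding S_def below_def by (rule subfield_gen_field)+

lemma below_S: "below v \<subseteq> S"
  unfolding below_def S_def by (rule gen_field_mono) auto

lemma below_mono: "rk u \<le> rk v \<Longrightarrow> below u \<subseteq> below v"
  unfolding below_def by (intro gen_field_mono image_mono) auto

lemma L_below: "x \<in> L \<Longrightarrow> \<iota> x \<in> below v"
  unfolding below_def by (rule subsetD[OF gen_field_base]) auto

lemma X_below: "u \<in> N \<Longrightarrow> rk u < rk v \<Longrightarrow> X u \<in> below v"
  unfolding below_def by (rule subsetD[OF gen_field_gens]) auto

lemma L_S: "x \<in> L \<Longrightarrow> \<iota> x \<in> S"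
  using L_below below_S by blast

text \<open>The variables are independent over the image of \<open>L\<close>, so no relation
  restricts their derivatives and any family \<open>\<beta>\<close> may be prescribed.\<close>

lemma Der_exists:
  assumes i: "i < m"
  shows "\<exists>D. E.deriv_on S D \<and> (\<forall>x\<in>L. D (\<iota> x) = \<delta> i x) \<and> (\<forall>u\<in>N. D (X u) = \<beta> (shift i u))"
proof -
  define \<delta>' where "\<delta>' y = \<delta> i (the_inv \<iota> y)" for y
  have inj: "inj \<iota>" by (auto intro: injI)
  have \<delta>': "\<delta>' (\<iota> x) = \<delta> i x" for x unfolding \<delta>'_def by (simp add: the_inv_f_f[OF inj])
  have "E.deriv_on (\<iota> ` L) \<delta>'"
    unfolding E.deriv_on_def
  proof (intro ballI)
    fix x y assume "x \<in> \<iota> ` L" "y \<in> \<iota> ` L"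
    then obtain x' y' where xy: "x = \<iota> x'" "y = \<iota> y'" "x' \<in> L" "y' \<in> L" by blast
    have "\<delta>' (x + y) = \<delta> i (x' + y')" "\<delta>' (x * y) = \<delta> i (x' * y')"
      unfolding \<delta>'[symmetric] xy by simp_all
    then show "\<delta>' (x + y) = \<delta>' x + \<delta>' y \<and> \<delta>' (x * y) = id x * \<delta>' y + \<delta>' x * id y"
      using deriv_add[OF L_subfield \<delta>_deriv[OF i] xy(3,4)] deriv_mult[OF L_subfield \<delta>_deriv[OF i] xy(3,4)]
      unfolding xy \<delta>' by simp
  qed
  then obtain D where D: "E.deriv_on (gen_field (\<iota> ` L) (X ` N)) D" "\<And>x. x \<in> \<iota> ` L \<Longrightarrow> D x = \<delta>' x"
    "\<And>u. u \<in> N \<Longrightarrow> D (X u) = \<beta> (shift i u)"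
  proof (rule E.deriv_extension[OF subfield_image[OF L_subfield], where a = X and V = N and \<beta> = "\<lambda>u. \<beta> (shift i u)"])
    fix f assume f: "mpoly_over (\<iota> ` L) N f" "mpoly_eval f X = 0"
    have "mpoly_over (range \<iota>) I f" using f(1) unfolding mpoly_over_def N_def by blast
    then have "f = 0" using X_indep f(2) by blast
    then show "E.mpoly_deriv \<delta>' X (\<lambda>u. \<beta> (shift i u)) f = 0"
      unfolding E.mpoly_deriv_def coeff_sum_def by simp
  qed blast
  then show ?thesis using \<delta>' unfolding S_def by (intro exI[of _ D]) auto
qed

definition "Der i \<beta> = (SOME D. E.deriv_on S D \<and> (\<forall>x\<in>L. D (\<iota> x) = \<delta> i x) \<and> (\<forall>u\<in>N. D (X u) = \<beta> (shift i u)))"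

lemma Der:
  assumes "i < m"
  shows "E.deriv_on S (Der i \<beta>)" "\<And>x. x \<in> L \<Longrightarrow> Der i \<beta> (\<iota> x) = \<delta> i x"
    "\<And>u. u \<in> N \<Longrightarrow> Der i \<beta> (X u) = \<beta> (shift i u)"
  using someI_ex[OF Der_exists[OF assms, of \<beta>]] unfolding Der_def by blast+

lemma deriv_on_subset: "E.deriv_on S D \<Longrightarrow> T \<subseteq> S \<Longrightarrow> E.deriv_on T D"
  unfolding E.deriv_on_def by blast

text \<open>On \<open>below v\<close> a derivation sees only variables before v, whose derivatives
  precede \<open>shift i v\<close> by \<open>rank_shift_mono\<close>. Partial knowledge of
  \<open>\<beta>\<close> is therefore enough.\<close>

lemma Der_cong:
  assumes i: "i < m" and eq: "\<And>u. u \<in> N \<Longrightarrow> rk u < rk v \<Longrightarrow> \<beta> (shift i u) = \<beta>' (shift i u)"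
    and x: "x \<in> below v"
  shows "Der i \<beta> x = Der i \<beta>' x"
  using x unfolding below_def
proof (rule E.deriv_unique[rotated 3])
  show "E.deriv_on (gen_field (\<iota> ` L) (X ` {u \<in> N. rk u < rk v})) (Der i \<beta>)"
    "E.deriv_on (gen_field (\<iota> ` L) (X ` {u \<in> N. rk u < rk v})) (Der i \<beta>')"
    using deriv_on_subset[OF Der(1)[OF i] below_S] unfolding below_def by blast+
qed (use Der[OF i] eq in auto)

section \<open>Recursive values for the generators of all levels\<close>

definition "pred v = (SOME p. fst p < m \<and> lead (snd p) \<and> v = shift (fst p) (snd p))"

text \<open>Above level s a leader receives the derivative of the leader chosen by
  \<open>pred\<close>. Within the recursion \<open>f\<close> carries values only before v;
  \<open>b_pred\<close> shows that the cut does not show.\<close>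

definition b :: "(nat \<Rightarrow> nat) \<times> nat \<Rightarrow> 'e" where
  "b = wfrec (measure rk) (\<lambda>f v. if lv v \<le> s then b0 v
     else if lead v then Der (fst (pred v)) f (f (snd (pred v))) else X v)"

lemma pred: "lead v \<Longrightarrow> lv v > s \<Longrightarrow> fst (pred v) < m \<and> lead (snd (pred v)) \<and> v = shift (fst (pred v)) (snd (pred v))"
  unfolding pred_def by (rule someI_ex) (use lead_predecessor[of v] in auto)

lemma rk_pred: "lead v \<Longrightarrow> lv v > s \<Longrightarrow> rk (snd (pred v)) < rk v"
  using pred[of v] rank_shift[OF m lead_idx[of "snd (pred v)"], of "fst (pred v)"] by metis

lemma b_unfold: "b v = (if lv v \<le> s then b0 v else if lead v
     then Der (fst (pred v)) (cut b (measure rk) v) (b (snd (pred v))) else X v)"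
proof -
  have "b v = (if lv v \<le> s then b0 v else if lead v
     then Der (fst (pred v)) (cut b (measure rk) v) (cut b (measure rk) v (snd (pred v))) else X v)"
    unfolding b_def by (rule trans[OF wfrec[OF wf_measure]]) (rule refl)
  then show ?thesis using rk_pred[of v] by (auto simp: cut_apply)
qed

lemma b_low: "lv v \<le> s \<Longrightarrow> b v = b0 v"
  by (simp add: b_unfold)

text \<open>At level s, not being a leader means not being linear, so \<open>b0\<close> yields the
  variable; above level s the recursion does.\<close>

lemma b_free: "u \<in> N \<Longrightarrow> b u = X u"
  using b0_free[of u] lead_iff_low[of u] b_unfold[of u] unfolding N_def low_leader_def W_def by auto

lemma \<delta>_into:
  assumes i: "i < m" and R: "is_subfield R" "\<iota> ` L \<subseteq> R" and b: "\<And>u. u \<in> I \<Longrightarrow> lv u < s \<Longrightarrow> b (shift i u) \<in> R"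
  shows "\<delta> i ` L \<subseteq> R"
proof -
  have "submodule L R" unfolding submodule_def using is_subfieldD(1,3,4)[OF R(1)] R(2) by blast
  then show ?thesis
    unfolding L_def
  proof (rule deriv_gen_field_into[OF L_subfield \<delta>_deriv[OF i], rotated 2])
    show "\<delta> i ` K \<subseteq> R" using \<delta>_K[OF i] d_closed[OF i] K_L R(2) by (auto simp: image_subset_iff subset_iff)
    show "\<delta> i ` a ` {u \<in> I. lv u < s} \<subseteq> R"
    proof (rule image_subsetI, elim imageE)
      fix x u assume u: "x = a u" "u \<in> {u \<in> I. lv u < s}"
      then show "\<delta> i x \<in> R" using b[of u] \<delta>_a[OF i, of u] b_low[of "shift i u"] i by (simp add: level_shift)
    qed
  qed (simp_all add: L_def)
qed

lemma E_submodule_self: "is_subfield R \<Longrightarrow> E.submodule R R"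
  unfolding E.submodule_def using is_subfieldD(1,3,4)[of R] by simp

text \<open>Induction along the order. At level s a leader is linear and \<open>b0_lead\<close>
  applies. Above it, v is \<open>shift j u\<close> and the derivation maps \<open>below u\<close>
  into \<open>below v\<close>: it sends variables before u to values before v, and elements of
  \<open>L\<close> to expressions in values of level at most s.\<close>

lemma b_below:
  "v \<in> I \<Longrightarrow> (\<forall>w\<in>I. rk w < rk v \<longrightarrow> b w \<in> below v) \<and> (lead v \<longrightarrow> s \<le> lv v \<longrightarrow> b v \<in> below v)"
proof (induction "rk v" arbitrary: v rule: less_induct)
  case less
  have *: "b w \<in> below v" if w: "w \<in> I" "rk w < rk v" for w
  proof (cases "lv w < s")
    case True
    then show ?thesis using b_low[of w] b0_low[OF w(1)] L_below[OF a_L[OF w(1)]] by simp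
  next
    case False
    show ?thesis
    proof (cases "lead w")
      case True
      then show ?thesis using less(1)[OF w(2,1)] False below_mono[of w v] w by auto
    next
      case notlead: False
      then have "w \<in> N" using False w unfolding N_def by simp
      then show ?thesis using b_free X_below w(2) by simp
    qed
  qed
  moreover have "b v \<in> below v" if v: "lead v" "s \<le> lv v"
  proof (cases "lv v = s")
    case True
    then have vW: "v \<in> W" "linear_leader v"
      using lead_iff_low[OF less(2)] v less(2) unfolding low_leader_def W_def by auto
    have "{w \<in> W. rk w < rk v \<and> \<not> linear_leader w} \<subseteq> {u \<in> N. rk u < rk v}"
    proof safe
      fix \<xi> h assume w: "(\<xi>, h) \<in> W" "\<not> linear_leader (\<xi>, h)"
      then have wI: "(\<xi>, h) \<in> I" "lv (\<xi>, h) = s" unfolding W_def by auto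
      then show "(\<xi>, h) \<in> N" using lead_iff_low[OF wI(1)] w(2) unfolding low_leader_def N_def by auto
    qed
    then have "gen_field (\<iota> ` L) (X ` {w \<in> W. rk w < rk v \<and> \<not> linear_leader w}) \<subseteq> below v"
      unfolding below_def by (intro gen_field_mono image_mono) auto
    then show ?thesis using b0_lead[OF vW] b_low[of v] True by auto
  next
    case False
    then have lvv: "lv v > s" using v(2) by simp
    define j u where "j = fst (pred v)" and "u = snd (pred v)"
    have p: "j < m" "lead u" "v = shift j u" using pred[OF v(1) lvv] unfolding j_def u_def by auto
    have ru: "rk u < rk v" using rk_pred[OF v(1) lvv] unfolding u_def .
    have uI: "u \<in> I" using lead_idx[OF p(2)] .
    have lvu: "s \<le> lv u" using lvv p by (simp add: level_shift)
    let ?D = "Der j (cut b (measure rk) v)"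
    have "b u \<in> below u" using less(1)[OF ru uI] p(2) lvu by blast
    moreover have "?D ` below u \<subseteq> below v"
      unfolding below_def[of u]
    proof (rule E.deriv_gen_field_into[OF S_subfield Der(1)[OF p(1)], of _ _ "below v"])
      show "gen_field (\<iota> ` L) (X ` {w \<in> N. rk w < rk u}) \<subseteq> S" using below_S[of u] unfolding below_def .
      show "gen_field (\<iota> ` L) (X ` {w \<in> N. rk w < rk u}) \<subseteq> below v"
        using below_mono[of u v] ru unfolding below_def[of u] by simp
      show "E.submodule (below v) (below v)" by (rule E_submodule_self[OF below_subfield])
      have "\<delta> j ` L \<subseteq> below v"
      proof (rule \<delta>_into[OF p(1) below_subfield])
        show "\<iota> ` L \<subseteq> below v" using L_below by blast
        fix w assume w: "w \<in> I" "lv w < s"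
        have "rk (shift j w) < rk v"
          using w lvv p(1) less(2) by (intro level_rank[OF m]) (auto simp: shift_idx level_shift)
        then show "b (shift j w) \<in> below v" using *[OF shift_idx[OF w(1) p(1)]] by blast
      qed
      then show "?D ` \<iota> ` L \<subseteq> below v" using Der(2)[OF p(1)] by auto
      show "?D ` X ` {w \<in> N. rk w < rk u} \<subseteq> below v"
      proof (rule image_subsetI, elim imageE)
        fix x w assume w: "x = X w" "w \<in> {w \<in> N. rk w < rk u}"
        then have wI: "w \<in> I" "w \<in> N" "rk w < rk u" unfolding N_def by auto
        have r: "rk (shift j w) < rk v" unfolding p(3) by (rule rank_shift_mono[OF m wI(1) uI p(1) wI(3)])
        then show "?D x \<in> below v"
          using *[OF shift_idx[OF wI(1) p(1)] r] Der(3)[OF p(1) wI(2)] w(1) by (simp add: cut_apply)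
      qed
    qed
    ultimately have "?D (b u) \<in> below v" by blast
    then show ?thesis using b_unfold[of v] v(1) lvv unfolding j_def u_def by simp
  qed
  ultimately show ?case by blast
qed

lemma b_S: assumes "v \<in> I" shows "b v \<in> S"
  using b_below[OF shift_idx[OF assms m]] assms rank_shift[OF m assms m] below_S by blast

section \<open>The derivations of \<open>S\<close> and their commutators\<close>

definition "D i = Der i b"

lemma D_deriv: "i < m \<Longrightarrow> E.deriv_on S (D i)"
  unfolding D_def by (rule Der(1))

lemma D_L: "i < m \<Longrightarrow> x \<in> L \<Longrightarrow> D i (\<iota> x) = \<delta> i x"
  unfolding D_def by (rule Der(2))

lemma D_X: "i < m \<Longrightarrow> u \<in> N \<Longrightarrow> D i (X u) = b (shift i u)"
  unfolding D_def by (rule Der(3))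

lemma D_S:
  assumes i: "i < m" and x: "x \<in> S"
  shows "D i x \<in> S"
proof -
  have "D i ` S \<subseteq> S"
    unfolding S_def
  proof (rule E.deriv_gen_field_into[OF S_subfield D_deriv[OF i]])
    show "E.submodule S (gen_field (\<iota> ` L) (X ` N))" using E_submodule_self[OF S_subfield] unfolding S_def .
    have "\<delta> i ` L \<subseteq> S"
      using L_S b_S i by (intro \<delta>_into[OF i S_subfield]) (auto simp: shift_idx)
    then show "D i ` \<iota> ` L \<subseteq> gen_field (\<iota> ` L) (X ` N)" using D_L[OF i] unfolding S_def by auto
    show "D i ` X ` N \<subseteq> gen_field (\<iota> ` L) (X ` N)"
    proof (rule image_subsetI, elim imageE)
      fix x w assume "x = X w" "w \<in> N"
      moreover from this have "w \<in> I" unfolding N_def by blast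
      ultimately show "D i x \<in> gen_field (\<iota> ` L) (X ` N)"
        using D_X[OF i] b_S[OF shift_idx] i unfolding S_def by simp
    qed
  qed (simp_all add: S_def)
  then show ?thesis using x by blast
qed

text \<open>\<open>b u\<close> lies in \<open>below u\<close>, and shifts of variables before u
  precede v, so the cut family and the full one give the same derivative.\<close>

lemma b_pred:
  assumes v: "lead v" "lv v > s"
  shows "b v = D (fst (pred v)) (b (snd (pred v)))"
proof -
  define j u where "j = fst (pred v)" and "u = snd (pred v)"
  have p: "j < m" "lead u" "v = shift j u" using pred[OF v] unfolding j_def u_def by auto
  have uI: "u \<in> I" using lead_idx[OF p(2)] .
  have lvu: "s \<le> lv u" using v p by (simp add: level_shift)
  have "b v = Der j (cut b (measure rk) v) (b u)" using b_unfold[of v] v unfolding j_def u_def by simp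
  also have "\<dots> = Der j b (b u)"
  proof (rule Der_cong[OF p(1)])
    show "b u \<in> below u" using b_below[OF uI] p(2) lvu by blast
    show "cut b (measure rk) v (shift j w) = b (shift j w)" if "w \<in> N" "rk w < rk u" for w
      using rank_shift_mono[OF m _ uI p(1) that(2)] that(1) unfolding N_def p(3) by (simp add: cut_apply)
  qed
  finally show ?thesis unfolding D_def j_def u_def .
qed

definition "comm i j x = D i (D j x) - D j (D i x)"

text \<open>The mixed products \<open>D i x * D j y\<close> and \<open>D j x * D i y\<close>
  cancel.\<close>

lemma comm_deriv:
  assumes "i < m" "j < m"
  shows "E.deriv_on S (comm i j)"
  unfolding E.deriv_on_def
proof (intro ballI conjI)
  note DD = D_deriv[OF assms(1)] D_deriv[OF assms(2)]
  note S = is_subfieldD[OF S_subfield]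
  fix x y assume xy: "x \<in> S" "y \<in> S"
  have add: "D k (u + v) = D k u + D k v" and mult: "D k (u * v) = u * D k v + D k u * v"
    if "k < m" "u \<in> S" "v \<in> S" for k u v
    using D_deriv[OF that(1)] that(2,3) unfolding E.deriv_on_def by auto
  show "comm i j (x + y) = comm i j x + comm i j y"
    unfolding comm_def using xy assms by (simp add: add D_S)
  show "comm i j (x * y) = id x * comm i j y + comm i j x * id y"
    unfolding comm_def using xy assms by (simp add: add mult D_S S(4)) (simp add: algebra_simps)
qed

lemma comm_L_deriv:
  assumes "i < m" "j < m"
  shows "deriv_on L (\<lambda>x. comm i j (\<iota> x))"
  using comm_deriv[OF assms] L_S unfolding deriv_on_def E.deriv_on_def by simp

lemma comm_K:
  assumes ij: "i < m" "j < m" and x: "x \<in> K"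
  shows "comm i j (\<iota> x) = 0"
proof -
  have *: "D i' (D j' (\<iota> x)) = \<iota> (d i' (d j' x))" if "i' < m" "j' < m" for i' j'
    using that x K_L d_closed by (simp add: D_L \<delta>_K subsetD)
  have "d i (d j x) = d j (d i x)" using K ij x unfolding diff_field_def by blast
  then show ?thesis unfolding comm_def *[OF ij] *[OF ij(2,1)] by simp
qed

lemma comm_lower_field:
  assumes ij: "i < m" "j < m" and V: "V \<subseteq> {u \<in> I. lv u < s}" and z: "\<And>w. w \<in> V \<Longrightarrow> comm i j (b w) = 0"
  shows "(\<lambda>x. comm i j (\<iota> x)) ` gen_field K (a ` V) \<subseteq> {0}"
proof (rule deriv_gen_field_into[OF L_subfield comm_L_deriv[OF ij] _ _ submodule_zero])
  show sub: "gen_field K (a ` V) \<subseteq> L" unfolding L_def by (intro gen_field_mono image_mono V order_refl)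
  show "gen_field K (a ` V) \<subseteq> L" by (rule sub)
  show "(\<lambda>x. comm i j (\<iota> x)) ` K \<subseteq> {0}" using comm_K[OF ij] by auto
  show "(\<lambda>x. comm i j (\<iota> x)) ` a ` V \<subseteq> {0}"
  proof (rule image_subsetI, elim imageE)
    fix x w assume "x = a w" "w \<in> V"
    then show "comm i j (\<iota> x) \<in> {0}" using z[of w] V b_low[of w] b0_low[of w] by auto
  qed
qed

text \<open>Below level s the leader is separable over its predecessors, so a derivation vanishing
  on these vanishes on it. From level s on separability is not involved: \<open>b t\<close> already
  lies in \<open>below t\<close>.\<close>

lemma comm_lead:
  assumes ij: "i < m" "j < m" and t: "lead t" and z: "\<And>w. w \<in> I \<Longrightarrow> rk w < rk t \<Longrightarrow> comm i j (b w) = 0"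
  shows "comm i j (b t) = 0"
proof (cases "lv t < s")
  case True
  have tI: "t \<in> I" using lead_idx[OF t] .
  have "low_leader t" using lead_iff_low[OF tI] True t by simp
  then have sep: "leader t" using True unfolding low_leader_def by simp
  have "(\<lambda>x. comm i j (\<iota> x)) ` lower_field t \<subseteq> {0}"
    unfolding lower_field_def
  proof (rule comm_lower_field[OF ij])
    show "{u \<in> I. rk u < rk t} \<subseteq> {u \<in> I. lv u < s}"
    proof (rule subsetI)
      fix u assume "u \<in> {u \<in> I. rk u < rk t}"
      then show "u \<in> {u \<in> I. lv u < s}" using rank_level[OF m _ tI, of u] True by simp
    qed
  qed (use z in simp)
  then have "comm i j (\<iota> (a t)) \<in> {0}"
    by (rule deriv_separable_into[OF L_subfield comm_L_deriv[OF ij] sep a_L[OF tI True] lower_field_in_L[OF tI True]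
          L_subfield lower_field_in_L[OF tI True] a_L[OF tI True] submodule_zero])
  then show ?thesis using b_low[of t] b0_low[OF tI True] True by simp
next
  case False
  have tI: "t \<in> I" using lead_idx[OF t] .
  have "comm i j ` below t \<subseteq> {0}"
    unfolding below_def
  proof (rule E.deriv_gen_field_into[OF S_subfield comm_deriv[OF ij] _ _ E.submodule_zero])
    show sub: "gen_field (\<iota> ` L) (X ` {u \<in> N. rk u < rk t}) \<subseteq> S" using below_S[of t] unfolding below_def .
    show "gen_field (\<iota> ` L) (X ` {u \<in> N. rk u < rk t}) \<subseteq> S" by (rule sub)
    have "(\<lambda>x. comm i j (\<iota> x)) ` L \<subseteq> {0}"
      unfolding L_def
    proof (rule comm_lower_field[OF ij order_refl])
      fix w assume w: "w \<in> {u \<in> I. lv u < s}"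
      then have "rk w < rk t" using False tI by (intro level_rank[OF m]) auto
      then show "comm i j (b w) = 0" using z w by simp
    qed
    then show "comm i j ` \<iota> ` L \<subseteq> {0}" by auto
    show "comm i j ` X ` {u \<in> N. rk u < rk t} \<subseteq> {0}"
    proof (rule image_subsetI, elim imageE)
      fix x w assume "x = X w" "w \<in> {u \<in> N. rk u < rk t}"
      then show "comm i j x \<in> {0}" using z[of w] b_free[of w] unfolding N_def by auto
    qed
  qed
  moreover have "b t \<in> below t" using b_below[OF tI] t False by simp
  ultimately show ?thesis by blast
qed

text \<open>Induction on the rank of z = \<open>shift i u\<close>. Below level s, and for a free u,
  the value is prescribed. For a leader u the value at z was defined through a possibly different
  predecessor v, and the two derivatives must be compared.\<close>

lemma D_b: "u \<in> I \<Longrightarrow> i < m \<Longrightarrow> D i (b u) = b (shift i u)"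
proof (induction "rk (shift i u)" arbitrary: i u rule: less_induct)
  case less
  note IH = less(1) and u = less(2) and i = less(3)
  consider "lv u < s" | "u \<in> N" | "s \<le> lv u" "lead u" using u unfolding N_def by force
  then show ?case
  proof cases
    case 1
    then show ?thesis using D_L[OF i a_L[OF u 1]] \<delta>_a[OF i u 1] b_low[of u] b0_low[OF u 1] b_low[of "shift i u"] i
      by (simp add: level_shift)
  next
    case 2
    then show ?thesis using D_X[OF i 2] b_free[OF 2] by simp
  next
    case 3
    let ?z = "shift i u"
    have zI: "?z \<in> I" using shift_idx[OF u i] .
    have z: "lead ?z" "lv ?z > s" using lead_shift[OF 3(2) i] 3(1) i by (simp_all add: level_shift)
    \<comment> \<open>When two predecessors of z are both derivatives of one leader t, their
      derivatives agree because the commutator vanishes at t.\<close>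
    have meet: "D k (b (shift l t)) = D l (b (shift k t))"
      if t: "lead t" "k < m" "l < m" "shift k (shift l t) = ?z" for t k l
    proof -
      have tI: "t \<in> I" using lead_idx[OF t(1)] .
      have step: "D k' (D l' (b w)) = b (shift k' (shift l' w))"
        if "w \<in> I" "k' < m" "l' < m" "rk (shift k' (shift l' w)) < rk ?z" for w k' l'
      proof -
        have "rk (shift l' w) < rk (shift k' (shift l' w))"
          using that by (intro rank_shift[OF m] shift_idx)
        then have "D l' (b w) = b (shift l' w)" using that IH[of l' w] by simp
        then show ?thesis using that IH[of k' "shift l' w"] by (simp add: shift_idx)
      qed
      have "comm k l (b t) = 0"
      proof (rule comm_lead[OF t(2,3,1)])
        fix w assume w: "w \<in> I" "rk w < rk t"
        \<comment> \<open>Since w precedes t, its second derivatives precede z, and the induction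
          hypothesis identifies them.\<close>
        have r: "rk (shift k (shift l w)) < rk ?z"
          unfolding t(4)[symmetric] using w tI t(2,3) by (intro rank_shift_mono[OF m] shift_idx)
        then have r': "rk (shift l (shift k w)) < rk ?z" by (simp add: shift_commute)
        show "comm k l (b w) = 0"
          unfolding comm_def step[OF w(1) t(2,3) r] step[OF w(1) t(3,2) r'] by (simp add: shift_commute)
      qed
      moreover have "D l (b t) = b (shift l t)"
        using tI t rank_shift[OF m shift_idx[OF tI t(3)] t(2)] by (intro IH) auto
      moreover have "D k (b t) = b (shift k t)"
        using tI t rank_shift[OF m shift_idx[OF tI t(2)] t(3)] shift_commute[of k l t] by (intro IH) auto
      ultimately show ?thesis unfolding comm_def by simp
    qed
    define j v where "j = fst (pred ?z)" and "v = snd (pred ?z)"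
    have p: "j < m" "lead v" "?z = shift j v" using pred[OF z] unfolding j_def v_def by auto
    have "D i (b u) = D j (b v)"
    proof (cases "i = j")
      case True
      then show ?thesis using p(3) shift_inj by metis
    next
      case False
      show ?thesis
      proof (rule lead_link[OF i p(1) 3(2) p(2,3) z(2) False])
        fix t assume t: "lead t" "u = shift j t" "v = shift i t"
        show ?thesis unfolding t(2,3) by (rule meet[OF t(1) i p(1)]) (simp add: t(2))
      next
        \<comment> \<open>Two comparisons through w: u with w at their meet t, then w with v at
          their meet t'.\<close>
        fix l w t t'
        assume l: "l < m" "shift l w = ?z" and t: "lead t" "u = shift l t" "w = shift i t"
          and t': "lead t'" "v = shift l t'" "w = shift j t'"
        have "D i (b u) = D l (b w)" unfolding t(2,3) by (rule meet[OF t(1) i l(1)]) (simp add: t(2))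
        also have "\<dots> = D j (b v)" unfolding t'(2,3) by (rule meet[OF t'(1) l(1) p(1)]) (use l(2) t'(3) in simp)
        finally show ?thesis .
      qed
    qed
    then show ?thesis using b_pred[OF z] unfolding j_def v_def by simp
  qed
qed

text \<open>The commutators vanish on \<open>K\<close> and, since shifts commute, on all values of
  \<open>b\<close>, which together generate \<open>S\<close>.\<close>

lemma D_commute:
  assumes ij: "i < m" "j < m" and x: "x \<in> S"
  shows "D i (D j x) = D j (D i x)"
proof -
  have z: "comm i j (b w) = 0" if "w \<in> I" for w
    using that ij by (simp add: comm_def D_b shift_idx shift_commute)
  have "comm i j ` S \<subseteq> {0}"
    unfolding S_def
  proof (rule E.deriv_gen_field_into[OF S_subfield comm_deriv[OF ij] _ _ E.submodule_zero])
    show "gen_field (\<iota> ` L) (X ` N) \<subseteq> S" "gen_field (\<iota> ` L) (X ` N) \<subseteq> S" unfolding S_def by simp_all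
    have "(\<lambda>x. comm i j (\<iota> x)) ` L \<subseteq> {0}"
      unfolding L_def by (rule comm_lower_field[OF ij order_refl]) (use z in simp)
    then show "comm i j ` \<iota> ` L \<subseteq> {0}" by auto
    show "comm i j ` X ` N \<subseteq> {0}"
    proof (rule image_subsetI, elim imageE)
      fix x w assume "x = X w" "w \<in> N"
      then show "comm i j x \<in> {0}" using z[of w] b_free[of w] unfolding N_def by auto
    qed
  qed
  then show ?thesis using x unfolding comm_def by auto
qed

end

section \<open>Realising the extension on lists\<close>

text \<open>The target is the fraction field of the polynomials over \<open>'a\<close> in countably
  many variables; variable k will belong to the index of rank k.\<close>

definition const_fract :: "'a::field \<Rightarrow> ((nat, 'a) mpoly) fract" where
  "const_fract c = to_fract (Poly_Mapping.single 0 c)"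

definition var_fract :: "nat \<Rightarrow> ((nat, 'a::field) mpoly) fract" where
  "var_fract k = to_fract (Poly_Mapping.single (Poly_Mapping.single k 1) 1)"

lemma field_map_const_fract: "field_map const_fract"
  by unfold_locales (simp_all add: const_fract_def single_add mult_single flip: to_fract_add to_fract_mult)

lemma to_fract_sum: "to_fract (sum f A) = (\<Sum>x\<in>A. to_fract (f x))"
  by (induction A rule: infinite_finite_induct) auto

definition rename_monom :: "('v \<Rightarrow> nat) \<Rightarrow> ('v \<Rightarrow>\<^sub>0 nat) \<Rightarrow> (nat \<Rightarrow>\<^sub>0 nat)" where
  "rename_monom code t = (\<Sum>v\<in>Poly_Mapping.keys t. Poly_Mapping.single (code v) (poly_mapping.lookup t v))"

lemma var_fract_power:
  "var_fract k ^ e = (to_fract (Poly_Mapping.single (Poly_Mapping.single k e) 1) :: ((nat, 'a::field) mpoly) fract)"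
  by (induction e) (simp_all add: var_fract_def mult_single single_add[symmetric] flip: to_fract_mult)

lemma monom_val_var_fract:
  "monom_val t (\<lambda>v. var_fract (code v)) =
    (to_fract (Poly_Mapping.single (rename_monom code t) 1) :: ((nat, 'a::field) mpoly) fract)"
proof -
  have "(\<Prod>v\<in>A. var_fract (code v) ^ poly_mapping.lookup t v) =
    (to_fract (Poly_Mapping.single (\<Sum>v\<in>A. Poly_Mapping.single (code v) (poly_mapping.lookup t v)) 1) :: ((nat, 'a) mpoly) fract)"
    if "finite A" for A
    using that by (induction A) (simp_all add: var_fract_power mult_single flip: to_fract_mult)
  then show ?thesis unfolding monom_val_def rename_monom_def by simp
qed

lemma rename_monom_lookup:
  assumes "inj_on code V" "Poly_Mapping.keys t \<subseteq> V" "v \<in> V"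
  shows "poly_mapping.lookup (rename_monom code t) (code v) = poly_mapping.lookup t v"
proof -
  have "poly_mapping.lookup (rename_monom code t) (code v) =
      (\<Sum>w\<in>Poly_Mapping.keys t. if w = v then poly_mapping.lookup t w else 0)"
    unfolding rename_monom_def lookup_sum using assms
    by (intro sum.cong) (auto simp: lookup_single when_def inj_on_def)
  then show ?thesis by (simp add: in_keys_iff)
qed

lemma rename_monom_inj:
  assumes "inj_on code V" "Poly_Mapping.keys t \<subseteq> V" "Poly_Mapping.keys t' \<subseteq> V" "rename_monom code t = rename_monom code t'"
  shows "t = t'"
proof (rule poly_mapping_eqI)
  fix v
  show "poly_mapping.lookup t v = poly_mapping.lookup t' v"
  proof (cases "v \<in> V")
    case True
    then show ?thesis using rename_monom_lookup[OF assms(1)] assms(2-4) by metis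
  next
    case False
    then have "v \<notin> Poly_Mapping.keys t" "v \<notin> Poly_Mapping.keys t'" using assms(2,3) by auto
    then show ?thesis by (simp add: in_keys_iff)
  qed
qed

text \<open>With constants as coefficients, f evaluates to the image of a polynomial obtained by
  renaming variables. Injective renaming merges no monomials, so each coefficient of f
  survives.\<close>

lemma var_fract_independent:
  assumes code: "inj_on code V" and f: "mpoly_over (range const_fract) V f" and 0: "mpoly_eval f (\<lambda>v. var_fract (code v)) = 0"
  shows "f = (0 :: ('v, ((nat, 'a::field) mpoly) fract) mpoly)"
proof (rule ccontr)
  assume "f \<noteq> 0"
  then obtain t0 where t0: "t0 \<in> Poly_Mapping.keys f" by (metis keys_eq_empty ex_in_conv)
  define c where "c t = (SOME x. const_fract x = poly_mapping.lookup f t)" for t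
  have c: "const_fract (c t) = poly_mapping.lookup f t" if "t \<in> Poly_Mapping.keys f" for t
  proof -
    have "poly_mapping.lookup f t \<in> range const_fract" using f that unfolding mpoly_over_def by blast
    then have "\<exists>x. const_fract x = poly_mapping.lookup f t" by (metis imageE)
    then show ?thesis unfolding c_def by (rule someI_ex)
  qed
  let ?g = "\<Sum>t\<in>Poly_Mapping.keys f. Poly_Mapping.single (rename_monom code t) (c t)"
  have "mpoly_eval f (\<lambda>v. var_fract (code v)) = (\<Sum>t\<in>Poly_Mapping.keys f. to_fract (Poly_Mapping.single (rename_monom code t) (c t)))"
    unfolding mpoly_eval_def
    by (rule sum.cong) (simp_all add: c[symmetric] monom_val_var_fract const_fract_def mult_single flip: to_fract_mult)
  then have "to_fract ?g = 0" using 0 by (simp only: to_fract_sum)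
  then have "?g = 0" by (simp only: to_fract_eq_0_iff)
  then have "poly_mapping.lookup ?g (rename_monom code t0) = 0" by (simp only: lookup_zero)
  moreover have "poly_mapping.lookup ?g (rename_monom code t0) = (\<Sum>t\<in>Poly_Mapping.keys f. if t = t0 then c t else 0)"
    unfolding lookup_sum
  proof (rule sum.cong[OF refl])
    fix t assume t: "t \<in> Poly_Mapping.keys f"
    have "rename_monom code t = rename_monom code t0 \<longleftrightarrow> t = t0"
      using rename_monom_inj[OF code, of t t0] f t t0 unfolding mpoly_over_def by auto
    then show "poly_mapping.lookup (Poly_Mapping.single (rename_monom code t) (c t)) (rename_monom code t0) = (if t = t0 then c t else 0)"
      by (simp add: lookup_single when_def)
  qed
  ultimately have "c t0 = 0" using t0 by simp
  then have "poly_mapping.lookup f t0 = 0" using c[OF t0] by (simp add: const_fract_def)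
  then show False using t0 by (simp add: in_keys_iff)
qed

text \<open>A prefix-free code for lists, with 1 announcing a further entry and 0 the end.\<close>
definition block :: "'a::zero_neq_one list \<Rightarrow> 'a list" where
  "block xs = concat (map (\<lambda>x. [1, x]) xs) @ [0]"

lemma block_append_inj: "block xs @ r = block ys @ r' \<Longrightarrow> xs = ys \<and> r = r'"
proof (induction xs arbitrary: ys)
  case Nil
  then show ?case by (cases ys) (auto simp: block_def)
next
  case (Cons x xs)
  then show ?case by (cases ys) (auto simp: block_def)
qed

lemma inj_concat_block: "inj (\<lambda>xss. concat (map block xss))"
proof (rule injI)
  fix xss yss :: "'a list list"
  show "concat (map block xss) = concat (map block yss) \<Longrightarrow> xss = yss"
  proof (induction xss arbitrary: yss)
    case Nil
    then show ?case by (cases yss) (auto simp: block_def)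
  next
    case (Cons xs xss)
    then obtain ys yss' where "yss = ys # yss'" by (cases yss) (auto simp: block_def)
    then show ?case using Cons block_append_inj[of xs "concat (map block xss)" ys "concat (map block yss')"] by simp
  qed
qed

text \<open>A finitely supported map is listed as coded key-value pairs. The order of the keys is an
  arbitrary choice, but the code reveals it together with the values.\<close>

lemma inj_poly_mapping_list:
  fixes ek :: "'k \<Rightarrow> 'a::zero_neq_one list" and ev :: "'v::zero \<Rightarrow> 'a list"
  assumes "inj ek" "inj ev"
  shows "\<exists>e :: ('k \<Rightarrow>\<^sub>0 'v) \<Rightarrow> 'a list. inj e"
proof -
  define ks where "ks f = (SOME l. set l = Poly_Mapping.keys f)" for f :: "'k \<Rightarrow>\<^sub>0 'v"
  have ks: "set (ks f) = Poly_Mapping.keys f" for f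
    unfolding ks_def by (rule someI_ex) (simp add: finite_list)
  let ?p = "\<lambda>f k. concat (map block [ek k, ev (poly_mapping.lookup f k)])"
  have p: "k = k' \<and> poly_mapping.lookup f k = poly_mapping.lookup g k'" if "?p f k = ?p g k'" for f g k k'
    using injD[OF inj_concat_block that] injD[OF assms(1)] injD[OF assms(2)] by simp
  have "inj (\<lambda>f. concat (map block (map (?p f) (ks f))))"
  proof (rule injI)
    fix f g assume "concat (map block (map (?p f) (ks f))) = concat (map block (map (?p g) (ks g)))"
    then have eq: "map (?p f) (ks f) = map (?p g) (ks g)" by (rule injD[OF inj_concat_block])
    then have len: "length (ks f) = length (ks g)" by (rule map_eq_imp_length_eq)
    have nth: "ks f ! i = ks g ! i \<and> poly_mapping.lookup f (ks f ! i) = poly_mapping.lookup g (ks g ! i)"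
      if "i < length (ks f)" for i
      using arg_cong[OF eq, of "\<lambda>l. l ! i"] that len by (intro p) simp
    have ksfg: "ks f = ks g" by (rule nth_equalityI) (use len nth in auto)
    show "f = g"
    proof (rule poly_mapping_eqI)
      fix k
      show "poly_mapping.lookup f k = poly_mapping.lookup g k"
      proof (cases "k \<in> Poly_Mapping.keys f")
        case True
        then obtain i where "i < length (ks f)" "k = ks f ! i" using ks[of f] by (metis in_set_conv_nth)
        then show ?thesis using nth ksfg by metis
      next
        case False
        then have "k \<notin> Poly_Mapping.keys g" using ks[of f] ks[of g] ksfg by simp
        then show ?thesis using False by (simp add: in_keys_iff)
      qed
    qed
  qed
  then show ?thesis by blast
qed

lemma inj_fract_list:
  fixes e :: "'b::idom \<Rightarrow> 'a::zero_neq_one list"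
  assumes "inj e"
  shows "\<exists>e' :: 'b fract \<Rightarrow> 'a list. inj e'"
proof -
  define r where "r x = (SOME p. x = Fract (fst p) (snd p))" for x :: "'b fract"
  have r: "x = Fract (fst (r x)) (snd (r x))" for x
    unfolding r_def by (rule someI_ex) (metis Fract_cases fst_conv snd_conv)
  have "inj (\<lambda>x. concat (map block [e (fst (r x)), e (snd (r x))]))"
  proof (rule injI)
    fix x y assume "concat (map block [e (fst (r x)), e (snd (r x))]) = concat (map block [e (fst (r y)), e (snd (r y))])"
    then have "[e (fst (r x)), e (snd (r x))] = [e (fst (r y)), e (snd (r y))]" by (rule injD[OF inj_concat_block])
    then have "r x = r y" using injD[OF assms] by (simp add: prod_eq_iff)
    then show "x = y" using r by metis
  qed
  then show ?thesis by blast
qed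

text \<open>Naturals are coded in unary by lists of zeros, coefficients by singletons. Lists leave
  enough room even when \<open>'a\<close> is finite.\<close>

lemma inj_mpoly_fract_list: "\<exists>e :: ((nat, 'a::field) mpoly) fract \<Rightarrow> 'a list. inj e"
proof -
  have nat: "inj (\<lambda>k. replicate k (0::'a))" by (auto intro: injI)
  obtain e1 :: "(nat \<Rightarrow>\<^sub>0 nat) \<Rightarrow> 'a list" where "inj e1" using inj_poly_mapping_list[OF nat nat] by blast
  moreover have "inj (\<lambda>x::'a. [x])" by (auto intro: injI)
  ultimately obtain e2 :: "(nat, 'a) mpoly \<Rightarrow> 'a list" where "inj e2" using inj_poly_mapping_list by blast
  then show ?thesis by (rule inj_fract_list)
qed

section \<open>Transport of the field and its derivations to another type\<close>

definition ring_copy :: "('e::field \<Rightarrow> 'b) \<Rightarrow> 'e set \<Rightarrow> 'b ring" where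
  "ring_copy enc S = \<lparr>carrier = enc ` S, mult = (\<lambda>x y. enc (the_inv enc x * the_inv enc y)), one = enc 1,
     zero = enc 0, add = (\<lambda>x y. enc (the_inv enc x + the_inv enc y))\<rparr>"

lemma field_ring_copy:
  assumes "inj enc" "is_subfield S"
  shows "field (ring_copy enc S)"
proof -
  note S = is_subfieldD[OF assms(2)]
  have [simp]: "the_inv enc (enc x) = x" for x using the_inv_f_f[OF assms(1)] .
  have [simp]: "enc x = enc y \<longleftrightarrow> x = y" for x y using assms(1) by (simp add: inj_eq)
  have [simp]: "enc x \<in> enc ` S \<longleftrightarrow> x \<in> S" for x using assms(1) by (simp add: inj_image_mem_iff)
  interpret cring "ring_copy enc S"
  proof (rule cringI)
    show "abelian_group (ring_copy enc S)"
    proof (rule abelian_groupI)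
      fix x assume "x \<in> carrier (ring_copy enc S)"
      then obtain x' where "x = enc x'" "x' \<in> S" by (auto simp: ring_copy_def)
      then show "\<exists>y\<in>carrier (ring_copy enc S). y \<oplus>\<^bsub>ring_copy enc S\<^esub> x = \<zero>\<^bsub>ring_copy enc S\<^esub>"
        using S(5) by (intro bexI[of _ "enc (- x')"]) (auto simp: ring_copy_def)
    qed (use S in \<open>auto simp: ring_copy_def add_ac\<close>)
    show "Group.comm_monoid (ring_copy enc S)"
      by (rule comm_monoidI) (use S in \<open>auto simp: ring_copy_def mult_ac\<close>)
  qed (use S in \<open>auto simp: ring_copy_def distrib_right\<close>)
  show ?thesis
  proof (rule cring_fieldI)
    show "Units (ring_copy enc S) = carrier (ring_copy enc S) - {\<zero>\<^bsub>ring_copy enc S\<^esub>}"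
    proof (intro equalityI subsetI)
      fix x assume "x \<in> Units (ring_copy enc S)"
      then show "x \<in> carrier (ring_copy enc S) - {\<zero>\<^bsub>ring_copy enc S\<^esub>}"
        by (auto simp: Units_def ring_copy_def)
    next
      fix x assume "x \<in> carrier (ring_copy enc S) - {\<zero>\<^bsub>ring_copy enc S\<^esub>}"
      then obtain x' where x: "x = enc x'" "x' \<in> S" "x' \<noteq> 0" by (auto simp: ring_copy_def)
      then show "x \<in> Units (ring_copy enc S)"
        unfolding Units_def using S(6)[OF x(2)]
        by (intro CollectI conjI bexI[of _ "enc (inverse x')"]) (auto simp: ring_copy_def)
    qed
  qed
qed

text \<open>\<open>P\<close> collects the equations asked of the derivations, so that the extension
  of \<open>d\<close> and the relations among generators are carried over together.\<close>

lemma diff_field_copy: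
  fixes enc :: "'e::field \<Rightarrow> 'b" and \<iota> :: "'a::field \<Rightarrow> 'e" and D :: "nat \<Rightarrow> 'e \<Rightarrow> 'e"
  assumes enc: "inj enc" and S: "is_subfield S" and \<iota>: "field_map \<iota>" "\<iota> ` L \<subseteq> S"
    and D: "\<And>i. i < m \<Longrightarrow> field_map.deriv_on id S (D i)" "\<And>i x. i < m \<Longrightarrow> x \<in> S \<Longrightarrow> D i x \<in> S"
    and commute: "\<And>i j x. i < m \<Longrightarrow> j < m \<Longrightarrow> x \<in> S \<Longrightarrow> D i (D j x) = D j (D i x)"
    and prolong: "\<And>i x y. (i, x, y) \<in> P \<Longrightarrow> D i (\<iota> x) = \<iota> y"
  shows "\<exists>(M :: 'b ring) (D' :: nat \<Rightarrow> 'b \<Rightarrow> 'b) (\<kappa> :: 'a \<Rightarrow> 'b).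
    field M \<and> (\<forall>i<m. is_derivation_on M (D' i)) \<and>
    (\<forall>i<m. \<forall>j<m. \<forall>x\<in>carrier M. D' i (D' j x) = D' j (D' i x)) \<and>
    field_embedding L M \<kappa> \<and> (\<forall>(i, x, y)\<in>P. D' i (\<kappa> x) = \<kappa> y)"
proof (intro exI conjI)
  have [simp]: "the_inv enc (enc x) = x" for x using the_inv_f_f[OF enc] .
  interpret field_map \<iota> by (rule \<iota>(1))
  let ?M = "ring_copy enc S" and ?D = "\<lambda>i x. enc (D i (the_inv enc x))" and ?\<kappa> = "\<lambda>x. enc (\<iota> x)"
  have add: "D i (x + y) = D i x + D i y" and mult: "D i (x * y) = x * D i y + D i x * y"
    if "i < m" "x \<in> S" "y \<in> S" for i x y
    using D(1)[OF that(1)] that(2,3) unfolding field_map.deriv_on_def[OF field_map_id] by auto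
  show "field ?M" by (rule field_ring_copy[OF enc S])
  show "\<forall>i<m. is_derivation_on ?M (?D i)"
    unfolding is_derivation_on_def using D(2) by (auto simp: ring_copy_def add mult)
  show "\<forall>i<m. \<forall>j<m. \<forall>x\<in>carrier ?M. ?D i (?D j x) = ?D j (?D i x)"
    using commute by (auto simp: ring_copy_def)
  show "field_embedding L ?M ?\<kappa>"
    unfolding field_embedding_def using \<iota>(2) by (auto simp: ring_copy_def intro!: inj_onI dest!: injD[OF enc])
  show "\<forall>(i, x, y)\<in>P. ?D i (?\<kappa> x) = ?\<kappa> y"
  proof (rule ballI, clarify)
    fix i x y assume "(i, x, y) \<in> P"
    then show "?D i (?\<kappa> x) = ?\<kappa> y" using prolong[of i x y] by simp
  qed
qed

text \<open>The affine lift supplies level s, \<open>level_derivation\<close> the derivations of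
  \<open>L\<close> into the new field, and injectivity of the rank the independence of the
  variables.\<close>

lemma (in bounded_leaders) free_extension_exists:
  shows "\<exists>b0 \<delta>. free_extension m n \<mu> K d a const_fract (\<lambda>u. var_fract (rk u)) b0 \<delta>"
proof -
  interpret field_map "const_fract :: 'a \<Rightarrow> _" by (rule field_map_const_fract)
  let ?X = "\<lambda>u. var_fract (rk u) :: ((nat, 'a) mpoly) fract"
  obtain b where free: "\<And>v. v \<in> W \<Longrightarrow> \<not> linear_leader v \<Longrightarrow> b v = ?X v"
    and lead: "\<And>v. v \<in> W \<Longrightarrow> linear_leader v \<Longrightarrow>
      b v \<in> gen_field (const_fract ` L) (?X ` {w \<in> W. rk w < rk v \<and> \<not> linear_leader w})"
    and rel: "\<And>c0 c. c0 \<in> L \<Longrightarrow> (\<And>w. c w \<in> L) \<Longrightarrow> c0 + (\<Sum>w\<in>W. c w * a w) = 0 \<Longrightarrow>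
      const_fract c0 + (\<Sum>w\<in>W. const_fract (c w) * b w) = 0"
    using affine_lift[OF L_subfield W_finite W_inj, of a ?X] unfolding linear_leader_def[symmetric]
    by (elim exE conjE) blast
  \<comment> \<open>The lift speaks only of \<open>W\<close>; below level s the generators keep
    their own images.\<close>
  define b0 where "b0 u = (if lv u < s then const_fract (a u) else b u)" for u
  have b0_W: "b0 w = b w" if "w \<in> W" for w using that unfolding b0_def W_def by simp
  have "\<exists>\<delta>. deriv_on L \<delta> \<and> (\<forall>x\<in>K. \<delta> x = const_fract (d i x)) \<and> (\<forall>u\<in>I. lv u < s \<longrightarrow> \<delta> (a u) = b0 (shift i u))"
    if i: "i < m" for i
  proof (rule level_derivation[OF field_map_const_fract i, of b0])
    show "const_fract c0 + (\<Sum>w\<in>W. const_fract (c w) * b0 w) = 0"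
      if "c0 \<in> L" "\<And>w. c w \<in> L" "c0 + (\<Sum>w\<in>W. c w * a w) = 0" for c0 c
      using rel[OF that] by (simp add: b0_W)
  qed (auto simp: b0_def)
  then obtain \<delta> where \<delta>: "\<And>i. i < m \<Longrightarrow> deriv_on L (\<delta> i) \<and> (\<forall>x\<in>K. \<delta> i x = const_fract (d i x)) \<and>
      (\<forall>u\<in>I. lv u < s \<longrightarrow> \<delta> i (a u) = b0 (shift i u))"
    by metis
  have "free_extension m n \<mu> K d a const_fract ?X b0 \<delta>"
  proof
    show "f = 0" if "mpoly_over (range const_fract) I f" "mpoly_eval f ?X = 0" for f :: "(_, ((nat, 'a) mpoly) fract) mpoly"
      by (rule var_fract_independent[OF _ that]) (rule inj_onI, rule rank_inj[OF m])
  qed (use free lead \<delta> in \<open>simp_all add: b0_W, simp_all add: b0_def\<close>)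
  then show ?thesis by blast
qed

theorem theorem4p7:
  fixes m n :: nat and \<mu> :: "nat \<Rightarrow> nat"
    and K :: "'a::field set" and d :: "nat \<Rightarrow> 'a \<Rightarrow> 'a"
    and a :: "(nat \<Rightarrow> nat) \<times> nat \<Rightarrow> 'a"
  assumes "m > 0" and "n > 0"
    and "diff_field m K d"
    and "multi_index m \<mu>"
    and "differential_condition m n \<mu> K d a"
    and "\<And>\<sigma> k. (\<sigma>, k) \<in> gen_idx m n \<mu> \<Longrightarrow> min_separable_leader m n K a \<sigma> k \<Longrightarrow> mle m \<sigma> \<mu>"
  shows "\<exists>(M :: 'a list ring) (D :: nat \<Rightarrow> 'a list \<Rightarrow> 'a list) (\<iota> :: 'a \<Rightarrow> 'a list).
           field M \<and>
           (\<forall>i<m. is_derivation_on M (D i)) \<and>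
           (\<forall>i<m. \<forall>j<m. \<forall>x\<in>carrier M. D i (D j x) = D j (D i x)) \<and>
           field_embedding (gen_field K (a ` {(\<xi>, h). multi_index m \<xi> \<and> mabs m \<xi> < mabs m \<mu> \<and> h < n})) M \<iota> \<and>
           (\<forall>i<m. \<forall>x\<in>K. D i (\<iota> x) = \<iota> (d i x)) \<and>
           (\<forall>i<m. \<forall>k<n. \<forall>\<sigma>. multi_index m \<sigma> \<and> mabs m \<sigma> + 1 < mabs m \<mu> \<longrightarrow>
                D i (\<iota> (a (\<sigma>, k))) = \<iota> (a (madd \<sigma> (eps i), k)))"
    (is "\<exists>M D \<iota>. field M \<and> ?der M D \<and> ?com M D \<and> field_embedding ?L M \<iota> \<and> ?ext D \<iota> \<and> ?pro D \<iota>")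
proof -
  define P where "P = {(i, x, y). i < m \<and> x \<in> K \<and> y = d i x} \<union>
    {(i, x, y). \<exists>\<sigma> k. i < m \<and> k < n \<and> multi_index m \<sigma> \<and> mabs m \<sigma> + 1 < mabs m \<mu> \<and> x = a (\<sigma>, k) \<and> y = a (madd \<sigma> (eps i), k)}"
  have "\<exists>(M :: 'a list ring) D \<iota>. field M \<and> ?der M D \<and> ?com M D \<and> field_embedding ?L M \<iota> \<and>
      (\<forall>(i, x, y)\<in>P. D i (\<iota> x) = \<iota> y)"
  proof (cases "mabs m \<mu> > 0")
    case True
    interpret bounded_leaders m n \<mu> K d a
      by unfold_locales (use assms True in auto)
    obtain b0 \<delta> where "free_extension m n \<mu> K d a const_fract (\<lambda>u. var_fract (rk u)) b0 \<delta>"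
      using free_extension_exists by blast
    then interpret F: free_extension m n \<mu> K d a const_fract "\<lambda>u. var_fract (rk u)" b0 \<delta> .
    obtain enc :: "((nat, 'a) mpoly) fract \<Rightarrow> 'a list" where enc: "inj enc" using inj_mpoly_fract_list by blast
    have L: "?L = L" unfolding L_def idx_def level_def by (rule arg_cong[of _ _ "\<lambda>V. gen_field K (a ` V)"]) auto
    show ?thesis unfolding L
    proof (rule diff_field_copy[OF enc F.S_subfield field_map_const_fract _ F.D_deriv F.D_S F.D_commute])
      show "const_fract ` L \<subseteq> F.S" using F.L_S by blast
      fix i x y assume "(i, x, y) \<in> P"
      then consider "i < m" "x \<in> K" "y = d i x"
        | \<sigma> k where "i < m" "k < n" "multi_index m \<sigma>" "mabs m \<sigma> + 1 < mabs m \<mu>" "x = a (\<sigma>, k)" "y = a (madd \<sigma> (eps i), k)"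
        unfolding P_def by blast
      then show "F.D i (const_fract x) = const_fract y"
      proof cases
        case 1
        then show ?thesis using F.D_L[of i x] F.\<delta>_K[of i x] K_L by auto
      next
        case 2
        let ?u = "(\<sigma>, k)"
        have u: "?u \<in> I" "Suc (lv ?u) < s" using 2 unfolding idx_def level_def by auto
        have low: "F.b v = const_fract (a v)" if "v \<in> I" "lv v < s" for v
          using F.b_low[of v] F.b0_low[of v] that by simp
        have "F.D i (F.b ?u) = F.b (shift i ?u)" using F.D_b[OF u(1) 2(1)] .
        moreover have "shift i ?u \<in> I" "lv (shift i ?u) < s" using u 2(1) by (auto simp: shift_idx level_shift)
        ultimately show ?thesis using low u 2(5,6) by (simp add: shift_def)
      qed
    qed
  next
    case False
    \<comment> \<open>No level is below 0, so there are no generators, and \<open>K\<close> copied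
      to singleton lists serves as the extension.\<close>
    then have L: "?L = gen_field K {}" by simp
    have K: "is_subfield K" using assms(3) unfolding diff_field_def by blast
    have LK: "gen_field K {} \<subseteq> K" by (rule gen_field_least[OF K]) auto
    show ?thesis unfolding L
    proof (rule diff_field_copy[where enc = "\<lambda>x. [x]" and \<iota> = id and S = K and D = d, OF _ K field_map_id])
      show "field_map.deriv_on id K (d i)" if "i < m" for i
        using assms(3) that unfolding field_map.deriv_on_def[OF field_map_id] diff_field_def is_derivation_def by simp
      show "d i x \<in> K" if "i < m" "x \<in> K" for i x
        using assms(3) that unfolding diff_field_def is_derivation_def by simp
      show "d i (d j x) = d j (d i x)" if "i < m" "j < m" "x \<in> K" for i j x
        using assms(3) that unfolding diff_field_def by blast
      show "d i (id x) = id y" if "(i, x, y) \<in> P" for i x y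
        using that False unfolding P_def by auto
    qed (use LK in \<open>auto intro: injI\<close>)
  qed
  then obtain M :: "'a list ring" and D \<iota> where M: "field M" "?der M D" "?com M D" "field_embedding ?L M \<iota>"
    and P: "\<And>i x y. (i, x, y) \<in> P \<Longrightarrow> D i (\<iota> x) = \<iota> y" by blast
  have "?ext D \<iota>" using P unfolding P_def by blast
  moreover have "?pro D \<iota>" using P unfolding P_def by blast
  ultimately show ?thesis using M by blast
qed

end
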